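(* Let $\Phi$ be an irreducible crystallographic root system of rank $\ell$, $m\ge1$ and $0\le k\le\ell$. The number $f_{k-1}(\Phi,m)$ equals each of: (i) the number of pairs $(R,S)$ with $R$ a dominant region of $\mathcal A^m_\Phi$ and $S$ a set of $\ell-k$ walls of $R$ of the form $H_{\alpha,m}$ which separate $R$ from $A_\circ$; (ii) the number of pairs $(\mathcal I,T)$ with $\mathcal I$ a geometric chain of filters in $\Phi^+$ of length $m$ and $T$ a set of $\ell-k$ roots which are indecomposable of rank $m$ with respect to $\mathcal I$; (iii) the cardinality of $\mathcal F_k(\Phi,m)$.
   Context: $\Phi$ spans Euclidean $V$; positive system $\Phi^+$, simple roots $\Pi=\{\sigma_i\}$, highest root $\tilde\alpha$. $H_{\alpha,k}=\{x:(\alpha,x)=k\}$, $H^-_{\alpha,r}=\{x:(\alpha,x)<r\}$, $H^+_{\alpha,r}=\{x:(\alpha,x)>r\}$. $\mathcal A^m_\Phi$: all $H_{\alpha,k}$, $\alpha\in\Phi$, $0\le k\le m$; dominant = inside $\{x:(\alpha,x)>0\ \forall\alpha\in\Phi^+\}$; $A_\circ=\{x:(\sigma_i,x)>0,(\tilde\alpha,x)<1\}$; walls are hyperplanes supporting facets of the closure; separate = lie in different open half-spaces. $h_i(\Phi,m)$ is the number of dominant regions $R$ of $\mathcal A^m_\Phi$ for which exactly $\ell-i$ walls of $R$ of the form $H_{\alpha,m}$ separate $R$ from $A_\circ$; $f_{i-1}(\Phi,m)$ are defined by $\sum_{i=0}^\ell f_{i-1}(\Phi,m)(x-1)^{\ell-i}=\sum_{i=0}^\ell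 h_i(\Phi,m)x^{\ell-i}$. Root poset: $\alpha\le\beta$ iff $\beta-\alpha$ is a nonnegative combination of positive roots; filters are up-closed. A geometric chain of filters of length $m$ is a chain of filters $\Phi^+=\mathcal I_0\supseteq\mathcal I_1\supseteq\cdots\supseteq\mathcal I_m$ with $(\mathcal J_i+\mathcal J_j)\cap\Phi^+\subseteq\mathcal J_{i+j}$ for $i+j\le m$ ($\mathcal J_i=\Phi^+\setminus\mathcal I_i$) and $(\mathcal I_i+\mathcal I_j)\cap\Phi^+\subseteq\mathcal I_{i+j}$ for all $i,j\ge0$ (with $\mathcal I_i=\mathcal I_m$ for $i>m$). $\alpha$ is indecomposable of rank $m$ with respect to it if $\alpha\in\mathcal I_m$ and $\alpha\ne\beta+\gamma$ for all $\beta\in\mathcal I_i,\gamma\in\mathcal I_j$ with $i,j\ge0$, $i+j=m$. $\mathcal F_k(\Phi,m)$ is the collection of nonempty $k$-dimensional sets of the form $\bigcap_{(\alpha,r)\in\Phi^+\times\{0,\dots,m\}}\tilde H_{\alpha,r}$, where $\tilde H_{\alpha,0}=H^+_{\alpha,0}$, $\tilde H_{\alpha,m}\in\{H^-_{\alpha,m},H^+_{\alpha,m},H_{\alpha,m}\}$, and $\tilde H_{\alpha,r}\in\{H^-_{\alpha,r},H^+_{\alpha,r}\}$ for $1\le r<m$. *)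

theory Defs
  imports "HOL-Analysis.Analysis"
begin

definition hyp :: "'a::euclidean_space \<Rightarrow> real \<Rightarrow> 'a set" where
  "hyp \<alpha> r = {x. \<alpha> \<bullet> x = r}"

definition hlt :: "'a::euclidean_space \<Rightarrow> real \<Rightarrow> 'a set" where
  "hlt \<alpha> r = {x. \<alpha> \<bullet> x < r}"

definition hgt :: "'a::euclidean_space \<Rightarrow> real \<Rightarrow> 'a set" where
  "hgt \<alpha> r = {x. \<alpha> \<bullet> x > r}"

definition crystallographic_root_system :: "'a::euclidean_space set \<Rightarrow> bool" where
  "crystallographic_root_system \<Phi> \<longleftrightarrow>
     finite \<Phi> \<and> 0 \<notin> \<Phi> \<and> span \<Phi> = UNIV \<and>
     (\<forall>\<alpha>\<in>\<Phi>. \<forall>\<beta>\<in>\<Phi>. \<beta> - (2 * (\<beta> \<bullet> \<alpha>) / (\<alpha> \<bullet> \<alpha>)) *\<^sub>R \<alpha> \<in> \<Phi>) \<and>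
     (\<forall>\<alpha>\<in>\<Phi>. \<forall>c::real. c *\<^sub>R \<alpha> \<in> \<Phi> \<longrightarrow> c = 1 \<or> c = -1) \<and>
     (\<forall>\<alpha>\<in>\<Phi>. \<forall>\<beta>\<in>\<Phi>. 2 * (\<beta> \<bullet> \<alpha>) / (\<alpha> \<bullet> \<alpha>) \<in> \<int>)"

definition irreducible_root_system :: "'a::euclidean_space set \<Rightarrow> bool" where
  "irreducible_root_system \<Phi> \<longleftrightarrow>
     \<not> (\<exists>A B. A \<union> B = \<Phi> \<and> A \<inter> B = {} \<and> A \<noteq> {} \<and> B \<noteq> {} \<and>
            (\<forall>a\<in>A. \<forall>b\<in>B. a \<bullet> b = 0))"

definition is_base :: "'a::euclidean_space set \<Rightarrow> 'a set \<Rightarrow> bool" where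
  "is_base \<Phi> \<Delta> \<longleftrightarrow> \<Delta> \<subseteq> \<Phi> \<and> independent \<Delta> \<and>
     (\<forall>\<beta>\<in>\<Phi>. \<exists>c::'a \<Rightarrow> int. \<beta> = (\<Sum>\<sigma>\<in>\<Delta>. of_int (c \<sigma>) *\<^sub>R \<sigma>) \<and>
        ((\<forall>\<sigma>\<in>\<Delta>. c \<sigma> \<ge> 0) \<or> (\<forall>\<sigma>\<in>\<Delta>. c \<sigma> \<le> 0)))"

definition pos_roots :: "'a::euclidean_space set \<Rightarrow> 'a set \<Rightarrow> 'a set" where
  "pos_roots \<Phi> \<Delta> = {\<beta>\<in>\<Phi>. \<exists>c::'a \<Rightarrow> int. \<beta> = (\<Sum>\<sigma>\<in>\<Delta>. of_int (c \<sigma>) *\<^sub>R \<sigma>) \<and>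
        (\<forall>\<sigma>\<in>\<Delta>. c \<sigma> \<ge> 0)}"

definition root_le :: "'a::euclidean_space set \<Rightarrow> 'a \<Rightarrow> 'a \<Rightarrow> bool" where
  "root_le P \<alpha> \<beta> \<longleftrightarrow> \<alpha> \<in> P \<and> \<beta> \<in> P \<and>
     (\<exists>c::'a \<Rightarrow> real. (\<forall>\<gamma>\<in>P. c \<gamma> \<ge> 0) \<and> \<beta> - \<alpha> = (\<Sum>\<gamma>\<in>P. c \<gamma> *\<^sub>R \<gamma>))"

definition highest_root :: "'a::euclidean_space set \<Rightarrow> 'a" where
  "highest_root P = (THE \<alpha>. \<alpha> \<in> P \<and> (\<forall>\<beta>\<in>P. root_le P \<beta> \<alpha>))"

definition fund_alcove :: "'a::euclidean_space set \<Rightarrow> 'a set \<Rightarrow> 'a set" where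
  "fund_alcove \<Phi> \<Delta> = {x. (\<forall>\<sigma>\<in>\<Delta>. \<sigma> \<bullet> x > 0) \<and> highest_root (pos_roots \<Phi> \<Delta>) \<bullet> x < 1}"

definition dominant_cone :: "'a::euclidean_space set \<Rightarrow> 'a set" where
  "dominant_cone P = {x. \<forall>\<alpha>\<in>P. \<alpha> \<bullet> x > 0}"

definition arr_compl :: "'a::euclidean_space set \<Rightarrow> nat \<Rightarrow> 'a set" where
  "arr_compl \<Phi> m = - (\<Union>\<alpha>\<in>\<Phi>. \<Union>k\<in>{0..m}. hyp \<alpha> (real k))"

definition regions :: "'a::euclidean_space set \<Rightarrow> nat \<Rightarrow> 'a set set" where
  "regions \<Phi> m = {connected_component_set (arr_compl \<Phi> m) x | x. x \<in> arr_compl \<Phi> m}"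

definition dominant_regions :: "'a::euclidean_space set \<Rightarrow> 'a set \<Rightarrow> nat \<Rightarrow> 'a set set" where
  "dominant_regions \<Phi> \<Delta> m = {R \<in> regions \<Phi> m. R \<subseteq> dominant_cone (pos_roots \<Phi> \<Delta>)}"

definition is_wall :: "'a::euclidean_space set \<Rightarrow> 'a set \<Rightarrow> bool" where
  "is_wall R H \<longleftrightarrow> (\<exists>F. F facet_of closure R \<and> affine hull F = H)"

definition separates :: "'a::euclidean_space \<Rightarrow> real \<Rightarrow> 'a set \<Rightarrow> 'a set \<Rightarrow> bool" where
  "separates \<alpha> r X Y \<longleftrightarrow> (X \<subseteq> hlt \<alpha> r \<and> Y \<subseteq> hgt \<alpha> r) \<or> (X \<subseteq> hgt \<alpha> r \<and> Y \<subseteq> hlt \<alpha> r)"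

definition sep_walls :: "'a::euclidean_space set \<Rightarrow> 'a set \<Rightarrow> nat \<Rightarrow> 'a set \<Rightarrow> 'a set set" where
  "sep_walls \<Phi> \<Delta> m R = {H. \<exists>\<alpha>\<in>\<Phi>. H = hyp \<alpha> (real m) \<and> is_wall R H \<and>
                               separates \<alpha> (real m) R (fund_alcove \<Phi> \<Delta>)}"

definition h_num :: "'a::euclidean_space set \<Rightarrow> 'a set \<Rightarrow> nat \<Rightarrow> nat \<Rightarrow> nat" where
  "h_num \<Phi> \<Delta> m i = card {R \<in> dominant_regions \<Phi> \<Delta> m.
                              card (sep_walls \<Phi> \<Delta> m R) = DIM('a) - i}"

definition is_filter :: "'a::euclidean_space set \<Rightarrow> 'a set \<Rightarrow> bool" where
  "is_filter P F \<longleftrightarrow> F \<subseteq> P \<and> (\<forall>\<alpha>\<in>F. \<forall>\<beta>\<in>P. root_le P \<alpha> \<beta> \<longrightarrow> \<beta> \<in> F)"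

definition setsum :: "'a::euclidean_space set \<Rightarrow> 'a set \<Rightarrow> 'a set" where
  "setsum X Y = {\<beta> + \<gamma> | \<beta> \<gamma>. \<beta> \<in> X \<and> \<gamma> \<in> Y}"

text \<open>A chain I_0 \<supseteq> ... \<supseteq> I_m is encoded as a function on nat with I i = I m for i > m.\<close>
definition geometric_chain :: "'a::euclidean_space set \<Rightarrow> nat \<Rightarrow> (nat \<Rightarrow> 'a set) \<Rightarrow> bool" where
  "geometric_chain P m I \<longleftrightarrow>
     I 0 = P \<and> (\<forall>i\<le>m. is_filter P (I i)) \<and> (\<forall>i<m. I (Suc i) \<subseteq> I i) \<and>
     (\<forall>i>m. I i = I m) \<and>
     (\<forall>i j. i + j \<le> m \<longrightarrow> setsum (P - I i) (P - I j) \<inter> P \<subseteq> P - I (i + j)) \<and>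
     (\<forall>i j. setsum (I i) (I j) \<inter> P \<subseteq> I (i + j))"

definition indecomposable :: "'a::euclidean_space set \<Rightarrow> nat \<Rightarrow> (nat \<Rightarrow> 'a set) \<Rightarrow> 'a \<Rightarrow> bool" where
  "indecomposable P m I \<alpha> \<longleftrightarrow> \<alpha> \<in> I m \<and>
     \<not> (\<exists>i j \<beta> \<gamma>. i + j = m \<and> \<beta> \<in> I i \<and> \<gamma> \<in> I j \<and> \<alpha> = \<beta> + \<gamma>)"

definition signed_half :: "'a::euclidean_space \<Rightarrow> real \<Rightarrow> real \<Rightarrow> 'a set" where
  "signed_half \<alpha> r s = {x. sgn (\<alpha> \<bullet> x - r) = s}"

definition valid_signs :: "'a::euclidean_space set \<Rightarrow> nat \<Rightarrow> ('a \<Rightarrow> nat \<Rightarrow> real) \<Rightarrow> bool" where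
  "valid_signs P m s \<longleftrightarrow> (\<forall>\<alpha>\<in>P. s \<alpha> 0 = 1 \<and> (\<forall>r. 1 \<le> r \<and> r < m \<longrightarrow> s \<alpha> r \<in> {-1, 1}) \<and>
                              s \<alpha> m \<in> {-1, 0, 1})"

definition F_faces :: "'a::euclidean_space set \<Rightarrow> 'a set \<Rightarrow> nat \<Rightarrow> nat \<Rightarrow> 'a set set" where
  "F_faces \<Phi> \<Delta> m k = {X. (\<exists>s. valid_signs (pos_roots \<Phi> \<Delta>) m s \<and>
       X = \<Inter>{signed_half \<alpha> (real r) (s \<alpha> r) | \<alpha> r. \<alpha> \<in> pos_roots \<Phi> \<Delta> \<and> r \<le> m}) \<and>
       X \<noteq> {} \<and> aff_dim X = int k}"

end

theory Submission
  imports Defs "HOL-Library.Multiset"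
begin

text \<open>A point \<open>x\<close> of a dominant region, or of one of the faces on the hyperplanes \<open>H\<^bsub>\<alpha>,m\<^esub>\<close>, yields
  the geometric chain \<open>I r = {\<alpha>. (\<alpha>, x) > r}\<close> (with \<open>\<ge>\<close> for \<open>r = m\<close>) together with the set \<open>T\<close> of
  roots \<open>\<alpha>\<close> with \<open>(\<alpha>, x) = m\<close>, which are indecomposable of rank \<open>m\<close>. Conversely, for every chain
  \<open>I\<close> and every set \<open>T\<close> of indecomposables the corresponding system of linear equations and strict
  inequalities is solvable: by Motzkin's transposition theorem an obstruction would be an integer
  combination of roots, and it can be shortened using that the difference of two roots with
  positive inner product is a root. So the pairs \<open>(I, T)\<close> are the faces counted in (iii). Two
  distinct indecomposables form an obtuse angle, hence the indecomposables are linearly independent and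
  the face of \<open>(I, T)\<close> has codimension \<open>card T\<close>; for \<open>T = {\<alpha>}\<close> it spans a wall. The number of pairs is
  obtained from the \<open>h\<close>-numbers by the binomial theorem.\<close>

section \<open>Root systems with a base\<close>

text \<open>The closure conditions of a geometric chain are what keeps a shortened obstruction
  legal. For a lower bound \<open>r\<close> on \<open>a\<close> and an upper bound \<open>s\<close>
  on \<open>b\<close>, closure of the complements gives \<open>a - b\<close> the lower bound
  \<open>r - s\<close> (when \<open>s \<le> r\<close>), and closure of the filters gives
  \<open>b - a\<close> the upper bound \<open>s - r\<close>; for \<open>b\<close> in
  \<open>T\<close>, indecomposability takes over. One step exchanges single occurrences of roots, so
  the multipliers must be integers: the obstruction is then a pair of multisets whose total size
  decreases. Equality of the two multisets has to be tolerated inside \<open>T \<times> {m}\<close>,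
  where an equation contributes both bounds, and excluded once a pair of different roots has been
  merged. Irreducibility enters through the highest root: every positive root stays below 1 on the
  fundamental alcove, so a hyperplane of level \<open>m\<close> that separates has the alcove below
  it and the region above it.\<close>

lemma independent_if_obtuse:
  fixes T :: "'a::euclidean_space set"
  assumes fin: "finite T" and obt: "\<And>a b. a \<in> T \<Longrightarrow> b \<in> T \<Longrightarrow> a \<noteq> b \<Longrightarrow> a \<bullet> b \<le> 0"
    and pos: "\<And>a. a \<in> T \<Longrightarrow> a \<bullet> w > 0"
  shows "independent T"
proof -
  have no_pos: "c a \<le> 0" if c: "(\<Sum>a\<in>T. c a *\<^sub>R a) = 0" and a: "a \<in> T" for c a
  proof (rule ccontr)
    assume ca: "\<not> c a \<le> 0"
    define A where "A = {a\<in>T. c a > 0}"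
    \<comment> \<open>\<open>v\<close> is the positive part of the relation, hence minus its
      negative part, so \<open>v \<bullet> v\<close> is a sum of nonpositive terms and
      \<open>v = 0\<close>; pairing with \<open>w\<close> refutes this.\<close>
    define v where "v = (\<Sum>a\<in>A. c a *\<^sub>R a)"
    have A: "finite A" "A \<subseteq> T" using fin by (auto simp: A_def)
    have "v + (\<Sum>a\<in>T-A. c a *\<^sub>R a) = 0"
      using c sum.subset_diff[OF A(2) fin, of "\<lambda>a. c a *\<^sub>R a"] by (simp add: v_def add.commute)
    hence v': "v = (\<Sum>b\<in>T-A. (- c b) *\<^sub>R b)" by (simp add: sum_negf eq_neg_iff_add_eq_0)
    have "v \<bullet> v = (\<Sum>a\<in>A. \<Sum>b\<in>T-A. (c a * (- c b)) * (a \<bullet> b))"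
    proof -
      have "v \<bullet> v = (\<Sum>a\<in>A. c a *\<^sub>R a) \<bullet> (\<Sum>b\<in>T-A. (- c b) *\<^sub>R b)"
        using v_def v' by metis
      also have "\<dots> = (\<Sum>a\<in>A. \<Sum>b\<in>T-A. (c a * (- c b)) * (a \<bullet> b))"
        unfolding inner_sum_left[of _ A] unfolding inner_sum_right by (simp add: mult.assoc mult.left_commute)
      finally show ?thesis .
    qed
    also have "\<dots> \<le> 0"
    proof (intro sum_nonpos mult_nonneg_nonpos)
      fix x y assume xy: "x \<in> A" "y \<in> T - A"
      show "0 \<le> c x * - c y" using xy by (intro mult_nonneg_nonneg) (auto simp: A_def)
      show "x \<bullet> y \<le> 0" using xy A by (intro obt) auto
    qed
    finally have "v = 0" by (metis inner_ge_zero inner_eq_zero_iff antisym)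
    have aA: "a \<in> A" using a ca by (simp add: A_def)
    have "(\<Sum>x\<in>A. c x * (x \<bullet> w)) > 0"
      by (rule sum_pos2[OF A(1) aA]) (use ca a pos in \<open>auto simp: A_def less_imp_le\<close>)
    moreover have "(\<Sum>x\<in>A. c x * (x \<bullet> w)) = v \<bullet> w" by (simp add: v_def inner_sum_left)
    ultimately show False using \<open>v = 0\<close> by simp
  qed
  show ?thesis
  proof (rule independent_if_scalars_zero[OF fin])
    fix c a assume c: "(\<Sum>a\<in>T. c a *\<^sub>R a) = 0" and a: "a \<in> T"
    have "(\<Sum>a\<in>T. (- c a) *\<^sub>R a) = 0" using c by (simp add: sum_negf)
    from no_pos[OF c a] no_pos[OF this a] show "c a = 0" by simp
  qed
qed

text \<open>The coordinate functional of \<open>b\<close> extends linearly to the whole space, and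
  its adjoint at 1 is the vector that represents it.\<close>

lemma dual_basis_exists:
  fixes B :: "'a::euclidean_space set"
  assumes "independent B"
  shows "\<exists>\<omega>. \<forall>a\<in>B. \<forall>b\<in>B. a \<bullet> \<omega> b = (if a = b then 1 else (0::real))"
proof -
  have "\<exists>z. \<forall>a\<in>B. a \<bullet> z = (if a = b then 1 else (0::real))" for b
  proof -
    obtain g :: "'a \<Rightarrow> real" where g: "linear g" "\<forall>a\<in>B. g a = (if a = b then 1 else 0)"
      using linear_independent_extend[OF assms, of "\<lambda>a. if a = b then 1 else 0 :: real"] by auto
    have "a \<bullet> adjoint g 1 = g a" for a by (simp add: adjoint_works[OF g(1)])
    thus ?thesis using g(2) by (intro exI[of _ "adjoint g 1"]) simp
  qed
  thus ?thesis by metis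
qed

section \<open>Roots, simple coordinates and heights\<close>

locale based_root_system =
  fixes \<Phi> \<Delta> :: "'a::euclidean_space set"
  assumes crys: "crystallographic_root_system \<Phi>" and base: "is_base \<Phi> \<Delta>"
begin

abbreviation "P \<equiv> pos_roots \<Phi> \<Delta>"

lemma finite_roots: "finite \<Phi>" and zero_not_root: "0 \<notin> \<Phi>"
  using crys by (auto simp: crystallographic_root_system_def)

lemma uminus_root: "\<alpha> \<in> \<Phi> \<Longrightarrow> - \<alpha> \<in> \<Phi>"
proof -
  assume a: "\<alpha> \<in> \<Phi>"
  hence "\<alpha> - (2 * (\<alpha> \<bullet> \<alpha>) / (\<alpha> \<bullet> \<alpha>)) *\<^sub>R \<alpha> \<in> \<Phi>"
    using crys unfolding crystallographic_root_system_def by blast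
  moreover have "\<alpha> \<noteq> 0" using a zero_not_root by auto
  ultimately show ?thesis by (simp add: scaleR_2)
qed

lemma root_scaleR: "\<alpha> \<in> \<Phi> \<Longrightarrow> c *\<^sub>R \<alpha> \<in> \<Phi> \<Longrightarrow> c = 1 \<or> c = -1"
  using crys by (auto simp: crystallographic_root_system_def)

text \<open>The two Cartan integers are positive with product 4 cos^2 of the angle. If neither is 1,
  Cauchy-Schwarz is an equality, so the roots are proportional and, the system being reduced, equal.
  Reflecting with Cartan integer 1 subtracts one root from the other.\<close>

lemma root_diff:
  assumes a: "\<alpha> \<in> \<Phi>" and b: "\<beta> \<in> \<Phi>" and pos: "\<alpha> \<bullet> \<beta> > 0" and ne: "\<alpha> \<noteq> \<beta>"
  shows "\<alpha> - \<beta> \<in> \<Phi>"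
proof -
  have refl: "y - (2 * (y \<bullet> x) / (x \<bullet> x)) *\<^sub>R x \<in> \<Phi>" "2 * (y \<bullet> x) / (x \<bullet> x) \<in> \<int>"
    if "x \<in> \<Phi>" "y \<in> \<Phi>" for x y
    using crys that unfolding crystallographic_root_system_def by blast+
  have a0: "\<alpha> \<bullet> \<alpha> > 0" and b0: "\<beta> \<bullet> \<beta> > 0" using a b zero_not_root by auto
  obtain p where p: "2 * (\<alpha> \<bullet> \<beta>) / (\<beta> \<bullet> \<beta>) = of_int p" using refl(2)[OF b a] Ints_cases by blast
  obtain q where q: "2 * (\<beta> \<bullet> \<alpha>) / (\<alpha> \<bullet> \<alpha>) = of_int q" using refl(2)[OF a b] Ints_cases by blast
  have "real_of_int p > 0" unfolding p[symmetric] using pos b0 by simp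
  hence p0: "p \<ge> 1" by simp
  have "real_of_int q > 0" unfolding q[symmetric] using pos a0 by (simp add: inner_commute)
  hence q0: "q \<ge> 1" by simp
  have "p = 1 \<or> q = 1"
  proof (rule ccontr)
    assume "\<not> (p = 1 \<or> q = 1)"
    hence "p \<ge> 2" "q \<ge> 2" using p0 q0 by auto
    hence "p * q \<ge> 2 * 2" by (intro mult_mono) auto
    hence "real_of_int (p * q) \<ge> 4" by linarith
    moreover have "real_of_int (p * q) = 4 * (\<alpha> \<bullet> \<beta>)\<^sup>2 / ((\<alpha> \<bullet> \<alpha>) * (\<beta> \<bullet> \<beta>))"
      unfolding of_int_mult p[symmetric] q[symmetric]
      by (simp add: power2_eq_square inner_commute field_simps)
    ultimately have ge: "(\<alpha> \<bullet> \<beta>)\<^sup>2 \<ge> (\<alpha> \<bullet> \<alpha>) * (\<beta> \<bullet> \<beta>)" using a0 b0 by (simp add: field_simps)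
    have "(norm (\<alpha> \<bullet> \<beta>))\<^sup>2 \<ge> (norm \<alpha> * norm \<beta>)\<^sup>2"
      using ge by (simp add: power_mult_distrib power2_norm_eq_inner)
    hence "norm \<alpha> * norm \<beta> \<le> \<alpha> \<bullet> \<beta>" using pos by (smt (verit) power_mono_iff power2_le_imp_le real_norm_def norm_ge_zero zero_le_mult_iff)
    hence "\<alpha> \<bullet> \<beta> = norm \<alpha> * norm \<beta>" using norm_cauchy_schwarz[of \<alpha> \<beta>] by linarith
    hence par: "norm \<alpha> *\<^sub>R \<beta> = norm \<beta> *\<^sub>R \<alpha>" by (simp add: norm_cauchy_schwarz_eq)
    have na: "norm \<alpha> > 0" "norm \<beta> > 0" using a0 b0 by auto
    have "\<beta> = (norm \<beta> / norm \<alpha>) *\<^sub>R \<alpha>"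
      using arg_cong[OF par, of "\<lambda>v. (1 / norm \<alpha>) *\<^sub>R v"] na by simp
    moreover from this have "norm \<beta> / norm \<alpha> = 1 \<or> norm \<beta> / norm \<alpha> = -1"
      using root_scaleR[OF a] b by metis
    moreover have "norm \<beta> / norm \<alpha> > 0" using na by simp
    ultimately have "norm \<beta> / norm \<alpha> = 1" by linarith
    with \<open>\<beta> = (norm \<beta> / norm \<alpha>) *\<^sub>R \<alpha>\<close> show False using ne by (metis scaleR_one)
  qed
  thus ?thesis
  proof
    assume "p = 1" thus ?thesis using refl(1)[OF b a] p by simp
  next
    assume "q = 1" hence "\<beta> - \<alpha> \<in> \<Phi>" using refl(1)[OF a b] q by simp
    from uminus_root[OF this] show ?thesis by simp
  qed
qed

lemma indep_base: "independent \<Delta>" and base_sub: "\<Delta> \<subseteq> \<Phi>" and finite_base: "finite \<Delta>"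
  using base finite_roots by (auto simp: is_base_def intro: finite_subset)

text \<open>On the base these are the fundamental coweights, so the coefficient of \<open>a\<close>
  in \<open>\<beta>\<close> becomes the inner product \<open>\<beta> \<bullet> \<omega> a\<close>.
  Outside the base the values are arbitrary.\<close>

definition \<omega> :: "'a \<Rightarrow> 'a" where
  "\<omega> = (SOME \<omega>. \<forall>a\<in>\<Delta>. \<forall>b\<in>\<Delta>. a \<bullet> \<omega> b = (if a = b then 1 else (0::real)))"

lemma dual: "a \<in> \<Delta> \<Longrightarrow> b \<in> \<Delta> \<Longrightarrow> a \<bullet> \<omega> b = (if a = b then 1 else 0)"
  using someI_ex[OF dual_basis_exists[OF indep_base]] unfolding \<omega>_def by blast

lemma coord_sum: "b \<in> \<Delta> \<Longrightarrow> (\<Sum>a\<in>\<Delta>. c a *\<^sub>R a) \<bullet> \<omega> b = c b"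
proof -
  assume b: "b \<in> \<Delta>"
  have "(\<Sum>a\<in>\<Delta>. c a *\<^sub>R a) \<bullet> \<omega> b = (\<Sum>a\<in>\<Delta>. if a = b then c a else 0)"
    unfolding inner_sum_left by (intro sum.cong) (auto simp: dual b)
  thus ?thesis using b finite_base by simp
qed

lemma root_coords:
  assumes "\<beta> \<in> \<Phi>"
  shows "\<beta> = (\<Sum>a\<in>\<Delta>. (\<beta> \<bullet> \<omega> a) *\<^sub>R a)" and "\<And>a. a \<in> \<Delta> \<Longrightarrow> \<beta> \<bullet> \<omega> a \<in> \<int>"
    and "(\<forall>a\<in>\<Delta>. \<beta> \<bullet> \<omega> a \<ge> 0) \<or> (\<forall>a\<in>\<Delta>. \<beta> \<bullet> \<omega> a \<le> 0)"
proof -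
  obtain c :: "'a \<Rightarrow> int" where c: "\<beta> = (\<Sum>\<sigma>\<in>\<Delta>. of_int (c \<sigma>) *\<^sub>R \<sigma>)"
     "(\<forall>\<sigma>\<in>\<Delta>. c \<sigma> \<ge> 0) \<or> (\<forall>\<sigma>\<in>\<Delta>. c \<sigma> \<le> 0)"
    using base assms unfolding is_base_def by blast
  have cc: "\<beta> \<bullet> \<omega> a = of_int (c a)" if "a \<in> \<Delta>" for a
    using coord_sum[OF that, of "\<lambda>a. of_int (c a)"] c(1) by simp
  show "\<beta> = (\<Sum>a\<in>\<Delta>. (\<beta> \<bullet> \<omega> a) *\<^sub>R a)"
    by (subst c(1)) (intro sum.cong, auto simp: cc)
  show "\<And>a. a \<in> \<Delta> \<Longrightarrow> \<beta> \<bullet> \<omega> a \<in> \<int>" by (simp add: cc)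
  show "(\<forall>a\<in>\<Delta>. \<beta> \<bullet> \<omega> a \<ge> 0) \<or> (\<forall>a\<in>\<Delta>. \<beta> \<bullet> \<omega> a \<le> 0)" using c(2) by (auto simp: cc)
qed

lemma pos_roots_iff: "\<beta> \<in> P \<longleftrightarrow> \<beta> \<in> \<Phi> \<and> (\<forall>a\<in>\<Delta>. \<beta> \<bullet> \<omega> a \<ge> 0)"
proof
  assume "\<beta> \<in> P"
  then obtain c :: "'a \<Rightarrow> int" where c: "\<beta> \<in> \<Phi>" "\<beta> = (\<Sum>\<sigma>\<in>\<Delta>. of_int (c \<sigma>) *\<^sub>R \<sigma>)" "\<forall>\<sigma>\<in>\<Delta>. c \<sigma> \<ge> 0"
    unfolding pos_roots_def by blast
  have "\<beta> \<bullet> \<omega> a = of_int (c a)" if "a \<in> \<Delta>" for a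
    using coord_sum[OF that, of "\<lambda>a. of_int (c a)"] c(2) by simp
  thus "\<beta> \<in> \<Phi> \<and> (\<forall>a\<in>\<Delta>. \<beta> \<bullet> \<omega> a \<ge> 0)" using c by auto
next
  assume b: "\<beta> \<in> \<Phi> \<and> (\<forall>a\<in>\<Delta>. \<beta> \<bullet> \<omega> a \<ge> 0)"
  have "of_int \<lfloor>\<beta> \<bullet> \<omega> a\<rfloor> = \<beta> \<bullet> \<omega> a" if "a \<in> \<Delta>" for a
    using root_coords(2)[of \<beta> a] b that by (auto elim: Ints_cases)
  hence "(\<Sum>a\<in>\<Delta>. (\<beta> \<bullet> \<omega> a) *\<^sub>R a) = (\<Sum>a\<in>\<Delta>. of_int \<lfloor>\<beta> \<bullet> \<omega> a\<rfloor> *\<^sub>R a)"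
    by (intro sum.cong refl) metis
  hence "\<beta> = (\<Sum>a\<in>\<Delta>. of_int \<lfloor>\<beta> \<bullet> \<omega> a\<rfloor> *\<^sub>R a)"
    using root_coords(1)[of \<beta>] b by metis
  thus "\<beta> \<in> P" unfolding pos_roots_def using b by (auto intro!: exI[of _ "\<lambda>a. \<lfloor>\<beta> \<bullet> \<omega> a\<rfloor>"])
qed

lemma pos_root_root: "\<beta> \<in> P \<Longrightarrow> \<beta> \<in> \<Phi>" and finite_pos: "finite P"
  using finite_roots by (auto simp: pos_roots_def)

lemma pos_or_neg: "\<beta> \<in> \<Phi> \<Longrightarrow> \<beta> \<in> P \<or> - \<beta> \<in> P"
  using root_coords(3)[of \<beta>] uminus_root[of \<beta>] by (auto simp: pos_roots_iff)

lemma base_pos: "\<Delta> \<subseteq> P"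
  using base_sub by (auto simp: pos_roots_iff dual)

text \<open>The sum of the fundamental coweights, not half the sum of the positive roots:
  \<open>\<beta> \<bullet> \<rho>\<close> is the height of \<open>\<beta>\<close>.\<close>

definition \<rho> :: 'a where "\<rho> = (\<Sum>a\<in>\<Delta>. \<omega> a)"

lemma pos_coord_nonneg: "\<beta> \<in> P \<Longrightarrow> a \<in> \<Delta> \<Longrightarrow> \<beta> \<bullet> \<omega> a \<ge> 0"
  by (simp add: pos_roots_iff)

lemma height_ge1: "\<beta> \<in> P \<Longrightarrow> \<beta> \<bullet> \<rho> \<ge> 1"
proof -
  assume b: "\<beta> \<in> P"
  hence "\<beta> \<noteq> 0" using zero_not_root by (auto simp: pos_roots_iff)
  hence "(\<Sum>a\<in>\<Delta>. (\<beta> \<bullet> \<omega> a) *\<^sub>R a) \<noteq> 0" using root_coords(1)[OF pos_root_root[OF b]] by metis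
  then obtain a where a: "a \<in> \<Delta>" "\<beta> \<bullet> \<omega> a \<noteq> 0" by (metis (no_types, lifting) sum.neutral scaleR_eq_0_iff)
  have "\<beta> \<bullet> \<omega> a \<ge> 1"
    using root_coords(2)[OF pos_root_root[OF b] a(1)] pos_coord_nonneg[OF b a(1)] a(2)
    by (auto elim!: Ints_cases)
  also have "\<beta> \<bullet> \<omega> a \<le> (\<Sum>a\<in>\<Delta>. \<beta> \<bullet> \<omega> a)"
    by (rule member_le_sum) (use a b finite_base pos_coord_nonneg in auto)
  finally show ?thesis by (simp add: \<rho>_def inner_sum_right)
qed

lemma height_pos: "\<beta> \<in> P \<Longrightarrow> \<beta> \<bullet> \<rho> > 0"
  using height_ge1[of \<beta>] by linarith

lemma pos_root_diff:
  assumes "\<alpha> \<in> P" "\<beta> \<in> P" "\<alpha> \<bullet> \<beta> > 0" "\<alpha> \<noteq> \<beta>"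
  shows "\<alpha> - \<beta> \<in> P \<or> \<beta> - \<alpha> \<in> P"
  using pos_or_neg[OF root_diff[of \<alpha> \<beta>]] assms pos_root_root by auto

lemma pos_root_scaleR:
  assumes "\<alpha> \<in> P" "c *\<^sub>R \<alpha> \<in> P" shows "c = 1"
proof -
  have "c = 1 \<or> c = -1" using root_scaleR[OF pos_root_root pos_root_root] assms by simp
  moreover have "c \<noteq> -1" using height_pos[OF assms(1)] height_pos[OF assms(2)] by auto
  ultimately show ?thesis by blast
qed

lemma base_obtuse:
  assumes "\<sigma> \<in> \<Delta>" "\<tau> \<in> \<Delta>" "\<sigma> \<noteq> \<tau>" shows "\<sigma> \<bullet> \<tau> \<le> 0"
proof (rule ccontr)
  assume "\<not> \<sigma> \<bullet> \<tau> \<le> 0"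
  hence "\<sigma> - \<tau> \<in> \<Phi>" using assms base_sub by (intro root_diff) auto
  from root_coords(3)[OF this] assms show False by (force simp: inner_diff_left dual)
qed

text \<open>Removing a simple root \<open>a\<close> with positive inner product leaves a positive
  root \<open>\<delta>\<close> of smaller height. If \<open>a\<close> and \<open>\<delta>\<close>
  belonged to different orthogonal parts, the reflection in \<open>a\<close> would send
  \<open>a + \<delta>\<close> to \<open>\<delta> - a\<close>, whose coordinates have both
  signs.\<close>

lemma root_in_span_part:
  assumes D: "D1 \<union> D2 = \<Delta>" and orth: "\<And>a b. a \<in> D1 \<Longrightarrow> b \<in> D2 \<Longrightarrow> a \<bullet> b = 0"
    and b: "\<beta> \<in> P"
  shows "\<beta> \<in> span D1 \<or> \<beta> \<in> span D2"
  using b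
proof (induction "nat \<lfloor>\<beta> \<bullet> \<rho>\<rfloor>" arbitrary: \<beta> rule: less_induct)
  case less
  have bR: "\<beta> \<in> \<Phi>" using pos_root_root[OF less.prems] .
  have "\<beta> \<bullet> \<beta> > 0" using bR zero_not_root by auto
  also have "\<beta> \<bullet> \<beta> = (\<Sum>a\<in>\<Delta>. (\<beta> \<bullet> \<omega> a) * (\<beta> \<bullet> a))"
    by (subst (2) root_coords(1)[OF bR]) (simp add: inner_sum_right)
  finally have "\<exists>a\<in>\<Delta>. (\<beta> \<bullet> \<omega> a) * (\<beta> \<bullet> a) > 0" by (meson not_le sum_nonpos)
  then obtain a where a: "a \<in> \<Delta>" "(\<beta> \<bullet> \<omega> a) * (\<beta> \<bullet> a) > 0" by blast
  hence ba: "\<beta> \<bullet> a > 0" using pos_coord_nonneg[OF less.prems a(1)]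
    by (simp add: zero_less_mult_iff)
  have aR: "a \<in> \<Phi>" using a base_sub by auto
  show ?case
  proof (cases "\<beta> = a")
    case True thus ?thesis using a D by (auto simp: span_base)
  next
    case False
    define \<delta> where "\<delta> = \<beta> - a"
    have dR: "\<delta> \<in> \<Phi>" unfolding \<delta>_def using root_diff[OF bR aR ba False] .
    have dP: "\<delta> \<in> P"
    proof (rule ccontr)
      assume "\<delta> \<notin> P"
      hence nd: "- \<delta> \<in> P" using pos_or_neg[OF dR] by blast
      \<comment> \<open>If \<open>- \<delta>\<close> is positive, \<open>\<beta>\<close> is bounded
        coordinatewise by the simple root \<open>a\<close>, so it is a multiple of
        \<open>a\<close>.\<close>
      have "\<beta> \<bullet> \<omega> b = 0" if "b \<in> \<Delta>" "b \<noteq> a" for b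
        using pos_coord_nonneg[OF nd that(1)] pos_coord_nonneg[OF less.prems that(1)] that a
        by (simp add: \<delta>_def inner_diff_left dual)
      hence "(\<Sum>b\<in>\<Delta>. (\<beta> \<bullet> \<omega> b) *\<^sub>R b) = (\<Sum>b\<in>\<Delta>. if b = a then (\<beta> \<bullet> \<omega> b) *\<^sub>R b else 0)"
        by (intro sum.cong) auto
      hence "\<beta> = (\<beta> \<bullet> \<omega> a) *\<^sub>R a" using root_coords(1)[OF bR] a finite_base by simp
      moreover from this have "\<beta> \<bullet> \<omega> a = 1"
        using pos_root_scaleR[of a "\<beta> \<bullet> \<omega> a"] base_pos a less.prems by auto
      ultimately show False using False by simp
    qed
    have "\<delta> \<bullet> \<rho> = \<beta> \<bullet> \<rho> - a \<bullet> \<rho>" by (simp add: \<delta>_def inner_diff_left)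
    moreover have "a \<bullet> \<rho> \<ge> 1" "\<delta> \<bullet> \<rho> \<ge> 1" "\<beta> \<bullet> \<rho> \<ge> 1"
      using height_ge1 dP less.prems a base_pos by auto
    ultimately have "nat \<lfloor>\<delta> \<bullet> \<rho>\<rfloor> < nat \<lfloor>\<beta> \<bullet> \<rho>\<rfloor>" by linarith
    from less.hyps[OF this dP] have IH: "\<delta> \<in> span D1 \<or> \<delta> \<in> span D2" .
    have beq: "\<beta> = a + \<delta>" by (simp add: \<delta>_def)
    have mixed: False if a1: "a \<in> A" and d2: "\<delta> \<in> span B" and AB: "A \<union> B = \<Delta>"
      and o: "\<And>x y. x \<in> A \<Longrightarrow> y \<in> B \<Longrightarrow> x \<bullet> y = 0" for A B
    proof -
      have "orthogonal a \<delta>"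
        by (rule orthogonal_to_span[OF d2]) (use a1 o in \<open>auto simp: orthogonal_def\<close>)
      hence ad: "a \<bullet> \<delta> = 0" by (simp add: orthogonal_def)
      have "\<beta> - (2 * (\<beta> \<bullet> a) / (a \<bullet> a)) *\<^sub>R a \<in> \<Phi>"
        using crys bR aR unfolding crystallographic_root_system_def by blast
      moreover have "2 * (\<beta> \<bullet> a) / (a \<bullet> a) = 2"
        using ad aR zero_not_root by (auto simp: beq inner_add_right inner_commute)
      ultimately have R: "\<delta> - a \<in> \<Phi>" by (simp add: beq scaleR_2)
      have "\<delta> \<bullet> \<omega> a = 0"
      proof -
        have "a \<notin> B" using o[OF a1, of a] a1 aR zero_not_root by auto
        hence "orthogonal (\<omega> a) y" if "y \<in> B" for y
          using dual[of y a] that AB a by (auto simp: orthogonal_def inner_commute)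
        from orthogonal_to_span[OF d2 this] show ?thesis by (simp add: orthogonal_def inner_commute)
      qed
      hence neg: "(\<delta> - a) \<bullet> \<omega> a < 0" using a by (simp add: inner_diff_left dual)
      have "\<exists>b\<in>\<Delta>. (\<delta> - a) \<bullet> \<omega> b > 0"
      proof (rule ccontr)
        assume no: "\<not> (\<exists>b\<in>\<Delta>. (\<delta> - a) \<bullet> \<omega> b > 0)"
        have "\<delta> \<bullet> \<omega> b = 0" if "b \<in> \<Delta>" for b
        proof (cases "b = a")
          case False
          hence "(\<delta> - a) \<bullet> \<omega> b = \<delta> \<bullet> \<omega> b" using that a by (simp add: inner_diff_left dual)
          thus ?thesis using no that pos_coord_nonneg[OF dP that] by force
        qed (use \<open>\<delta> \<bullet> \<omega> a = 0\<close> in simp)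
        hence "\<delta> = 0" using root_coords(1)[OF dR] by simp
        thus False using dR zero_not_root by simp
      qed
      thus False using root_coords(3)[OF R] neg a by force
    qed
    show ?thesis
    proof (cases "a \<in> D1")
      case True
      hence "\<delta> \<in> span D1" using IH mixed[OF True _ D orth] by blast
      thus ?thesis using True unfolding beq by (auto intro: span_add span_base)
    next
      case False
      hence a2: "a \<in> D2" using a D by auto
      have "\<delta> \<in> span D2" using IH mixed[OF a2, of D1] D orth by (metis Un_commute inner_commute)
      thus ?thesis using a2 unfolding beq by (auto intro: span_add span_base)
    qed
  qed
qed

end

section \<open>The root poset, the highest root and the fundamental alcove\<close>

context based_root_system
begin

lemma inner_pos_root: "\<beta> \<in> P \<Longrightarrow> \<beta> \<bullet> x = (\<Sum>a\<in>\<Delta>. (\<beta> \<bullet> \<omega> a) * (a \<bullet> x))"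
  by (subst root_coords(1)[of \<beta>]) (auto simp: pos_root_root inner_sum_left)

text \<open>Pairing with the dual basis reduces the real combinations of positive roots in the
  definition to the coordinatewise order.\<close>

lemma root_le_iff:
  "root_le P \<alpha> \<beta> \<longleftrightarrow> \<alpha> \<in> P \<and> \<beta> \<in> P \<and> (\<forall>a\<in>\<Delta>. \<alpha> \<bullet> \<omega> a \<le> \<beta> \<bullet> \<omega> a)"
proof
  assume "root_le P \<alpha> \<beta>"
  then obtain c where c: "\<alpha> \<in> P" "\<beta> \<in> P" "\<forall>\<gamma>\<in>P. c \<gamma> \<ge> 0" "\<beta> - \<alpha> = (\<Sum>\<gamma>\<in>P. c \<gamma> *\<^sub>R \<gamma>)"
    unfolding root_le_def by blast
  have "\<alpha> \<bullet> \<omega> a \<le> \<beta> \<bullet> \<omega> a" if "a \<in> \<Delta>" for a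
  proof -
    have "(\<beta> - \<alpha>) \<bullet> \<omega> a = (\<Sum>\<gamma>\<in>P. c \<gamma> * (\<gamma> \<bullet> \<omega> a))" by (simp add: c(4) inner_sum_left)
    also have "\<dots> \<ge> 0" using c(3) pos_coord_nonneg that by (intro sum_nonneg mult_nonneg_nonneg) auto
    finally show ?thesis by (simp add: inner_diff_left)
  qed
  thus "\<alpha> \<in> P \<and> \<beta> \<in> P \<and> (\<forall>a\<in>\<Delta>. \<alpha> \<bullet> \<omega> a \<le> \<beta> \<bullet> \<omega> a)" using c by blast
next
  assume *: "\<alpha> \<in> P \<and> \<beta> \<in> P \<and> (\<forall>a\<in>\<Delta>. \<alpha> \<bullet> \<omega> a \<le> \<beta> \<bullet> \<omega> a)"
  let ?c = "\<lambda>a. if a \<in> \<Delta> then (\<beta> - \<alpha>) \<bullet> \<omega> a else 0"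
  have "\<beta> - \<alpha> = (\<Sum>a\<in>\<Delta>. (\<beta> \<bullet> \<omega> a) *\<^sub>R a) - (\<Sum>a\<in>\<Delta>. (\<alpha> \<bullet> \<omega> a) *\<^sub>R a)"
    using root_coords(1)[of \<alpha>] root_coords(1)[of \<beta>] * pos_root_root by metis
  also have "\<dots> = (\<Sum>a\<in>\<Delta>. ?c a *\<^sub>R a)"
    by (simp add: inner_diff_left scaleR_diff_left sum_subtractf)
  also have "\<dots> = (\<Sum>a\<in>P. ?c a *\<^sub>R a)"
    by (rule sum.mono_neutral_left) (use base_pos finite_pos in auto)
  finally show "root_le P \<alpha> \<beta>" unfolding root_le_def
    using * by (intro conjI exI[of _ ?c]) (auto simp: inner_diff_left)
qed

lemma root_le_eq_height:
  assumes "root_le P \<alpha> \<beta>" "\<beta> \<bullet> \<rho> \<le> \<alpha> \<bullet> \<rho>" shows "\<alpha> = \<beta>"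
proof -
  have le: "\<And>a. a \<in> \<Delta> \<Longrightarrow> \<alpha> \<bullet> \<omega> a \<le> \<beta> \<bullet> \<omega> a" and P: "\<alpha> \<in> P" "\<beta> \<in> P" using assms root_le_iff by auto
  have "(\<Sum>a\<in>\<Delta>. \<beta> \<bullet> \<omega> a - \<alpha> \<bullet> \<omega> a) \<le> 0" using assms(2) by (simp add: \<rho>_def inner_sum_right sum_subtractf)
  hence "(\<Sum>a\<in>\<Delta>. \<beta> \<bullet> \<omega> a - \<alpha> \<bullet> \<omega> a) = 0" using le by (intro antisym sum_nonneg) auto
  hence "\<And>a. a \<in> \<Delta> \<Longrightarrow> \<beta> \<bullet> \<omega> a = \<alpha> \<bullet> \<omega> a" using le finite_base
    by (subst (asm) sum_nonneg_eq_0_iff) auto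
  hence "(\<Sum>a\<in>\<Delta>. (\<beta> \<bullet> \<omega> a) *\<^sub>R a) = (\<Sum>a\<in>\<Delta>. (\<alpha> \<bullet> \<omega> a) *\<^sub>R a)" by simp
  thus ?thesis using root_coords(1)[of \<alpha>] root_coords(1)[of \<beta>] P pos_root_root by metis
qed

lemma root_le_diff: "\<alpha> \<in> P \<Longrightarrow> \<beta> \<in> P \<Longrightarrow> \<beta> - \<alpha> \<in> P \<Longrightarrow> root_le P \<alpha> \<beta>"
  using pos_coord_nonneg[of "\<beta> - \<alpha>"] by (auto simp: root_le_iff inner_diff_left)

lemma pos_nonempty: "P \<noteq> {}"
proof -
  have "\<Phi> \<noteq> {}"
  proof
    assume "\<Phi> = {}"
    hence "(UNIV :: 'a set) = {0}" using crys by (simp add: crystallographic_root_system_def)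
    thus False using nonzero_Basis nonempty_Basis by blast
  qed
  thus ?thesis using pos_or_neg by blast
qed

text \<open>A root of maximal height above \<open>\<beta>\<close> works. It is dominant, since
  otherwise adding a simple root would give a larger root. The simple roots missing from its support
  are then orthogonal to the support, so if there were any the root system would split.\<close>

lemma maximal_root_above:
  assumes irr: "irreducible_root_system \<Phi>" and b: "\<beta> \<in> P"
  obtains \<phi> where "root_le P \<beta> \<phi>" "\<And>\<psi>. root_le P \<phi> \<psi> \<Longrightarrow> \<phi> = \<psi>"
    "\<And>a. a \<in> \<Delta> \<Longrightarrow> \<phi> \<bullet> a \<ge> 0" "\<And>a. a \<in> \<Delta> \<Longrightarrow> \<phi> \<bullet> \<omega> a > 0"
proof -
  let ?U = "{\<phi>. root_le P \<beta> \<phi>}"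
  have fin: "finite ?U" by (rule finite_subset[OF _ finite_pos]) (auto simp: root_le_iff)
  moreover have "\<beta> \<in> ?U" using b by (simp add: root_le_iff)
  ultimately have "Max ((\<lambda>\<phi>. \<phi> \<bullet> \<rho>) ` ?U) \<in> (\<lambda>\<phi>. \<phi> \<bullet> \<rho>) ` ?U" by (intro Max_in) auto
  then obtain \<phi> where \<phi>: "\<phi> \<in> ?U" "\<phi> \<bullet> \<rho> = Max ((\<lambda>\<phi>. \<phi> \<bullet> \<rho>) ` ?U)" by auto
  hence le: "root_le P \<beta> \<phi>" by simp
  have \<phi>P: "\<phi> \<in> P" using le by (simp add: root_le_iff)
  have mx: "\<phi> = \<psi>" if "root_le P \<phi> \<psi>" for \<psi>
  proof (rule root_le_eq_height[OF that])
    have "root_le P \<beta> \<psi>" using le that by (force simp: root_le_iff intro: order_trans)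
    thus "\<psi> \<bullet> \<rho> \<le> \<phi> \<bullet> \<rho>" unfolding \<phi>(2) using fin by (intro Max_ge) auto
  qed
  have nn: "\<phi> \<bullet> a \<ge> 0" if a: "a \<in> \<Delta>" for a
  proof (rule ccontr)
    assume "\<not> \<phi> \<bullet> a \<ge> 0"
    hence "\<phi> \<bullet> (- a) > 0" by simp
    moreover have aP: "a \<in> P" using a base_pos by auto
    moreover have "\<phi> \<noteq> - a" using height_pos[OF aP] height_pos[OF \<phi>P] by auto
    ultimately have "\<phi> + a \<in> \<Phi>" using root_diff[of \<phi> "- a"] uminus_root pos_root_root \<phi>P by auto
    hence "\<phi> + a \<in> P" using pos_coord_nonneg[OF \<phi>P] pos_coord_nonneg[OF aP]
      by (auto simp: pos_roots_iff inner_add_left)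
    hence "root_le P \<phi> (\<phi> + a)" using \<phi>P aP by (intro root_le_diff) auto
    from mx[OF this] show False using aP zero_not_root pos_root_root by auto
  qed
  define D1 where "D1 = {a\<in>\<Delta>. \<phi> \<bullet> \<omega> a > 0}"
  define D2 where "D2 = {a\<in>\<Delta>. \<phi> \<bullet> \<omega> a = 0}"
  have D: "D1 \<union> D2 = \<Delta>" using pos_coord_nonneg[OF \<phi>P] by (force simp: D1_def D2_def)
  have orth: "a \<bullet> b = 0" if a: "a \<in> D1" and b: "b \<in> D2" for a b
  proof -
    \<comment> \<open>\<open>\<phi> \<bullet> b\<close> is nonnegative by dominance, but its
      expansion has only nonpositive terms because the base is obtuse; so every term
      vanishes.\<close>
    have np: "(\<phi> \<bullet> \<omega> c) * (c \<bullet> b) \<le> 0" if "c \<in> \<Delta>" for c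
    proof (cases "c = b")
      case False
      thus ?thesis using base_obtuse[of c b] that b pos_coord_nonneg[OF \<phi>P that]
        by (auto simp: D2_def intro: mult_nonneg_nonpos)
    qed (use b in \<open>auto simp: D2_def\<close>)
    have "0 \<le> \<phi> \<bullet> b" using nn b by (auto simp: D2_def)
    hence "(\<Sum>c\<in>\<Delta>. (\<phi> \<bullet> \<omega> c) * (c \<bullet> b)) = 0"
      using inner_pos_root[OF \<phi>P, of b] np by (intro antisym sum_nonpos) auto
    hence "(\<Sum>c\<in>\<Delta>. - ((\<phi> \<bullet> \<omega> c) * (c \<bullet> b))) = 0" by (simp add: sum_negf)
    hence "\<forall>c\<in>\<Delta>. - ((\<phi> \<bullet> \<omega> c) * (c \<bullet> b)) = 0"
      using np finite_base by (subst (asm) sum_nonneg_eq_0_iff) auto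
    thus ?thesis using a by (auto simp: D1_def)
  qed
  have "D2 = {}"
  proof (rule ccontr)
    assume D2: "D2 \<noteq> {}"
    have "\<exists>a\<in>\<Delta>. \<phi> \<bullet> \<omega> a > 0"
      using height_pos[OF \<phi>P] by (metis \<rho>_def inner_sum_right not_less sum_nonpos)
    hence D1: "D1 \<noteq> {}" by (auto simp: D1_def)
    have sub: "D1 \<subseteq> \<Phi>" "D2 \<subseteq> \<Phi>" using base_sub D by auto
    have mut: "x \<bullet> y = 0" if x: "x \<in> span D1" and y: "y \<in> span D2" for x y
    proof -
      have "orthogonal a y" if "a \<in> D1" for a
        by (rule orthogonal_to_span[OF y]) (use orth that in \<open>auto simp: orthogonal_def\<close>)
      hence "orthogonal y x" by (intro orthogonal_to_span[OF x]) (auto simp: orthogonal_commute)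
      thus ?thesis by (simp add: orthogonal_def inner_commute)
    qed
    have cover: "x \<in> span D1 \<or> x \<in> span D2" if "x \<in> \<Phi>" for x
      using pos_or_neg[OF that] root_in_span_part[OF D orth, of x] root_in_span_part[OF D orth, of "- x"]
      by (metis span_neg minus_minus)
    have "x = 0" if "x \<in> span D1" "x \<in> span D2" for x using mut[OF that] by simp
    hence "(\<Phi> \<inter> span D1) \<inter> (\<Phi> \<inter> span D2) = {}" using zero_not_root by auto
    moreover have "(\<Phi> \<inter> span D1) \<union> (\<Phi> \<inter> span D2) = \<Phi>" using cover by auto
    moreover have "\<Phi> \<inter> span D1 \<noteq> {}" "\<Phi> \<inter> span D2 \<noteq> {}" using D1 D2 sub by (auto dest: span_base)
    moreover have "\<forall>a\<in>\<Phi> \<inter> span D1. \<forall>b\<in>\<Phi> \<inter> span D2. a \<bullet> b = 0" using mut by auto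
    ultimately show False using irr unfolding irreducible_root_system_def by blast
  qed
  hence "\<And>a. a \<in> \<Delta> \<Longrightarrow> \<phi> \<bullet> \<omega> a > 0" using D by (auto simp: D1_def)
  thus ?thesis using that le mx nn by blast
qed

text \<open>A root with full support has positive inner product with every dominant root. Two
  maximal roots therefore differ by a root or coincide; in the first case they would be comparable.
  This uniqueness is what gives the definite description in \<open>highest_root\<close> its
  meaning.\<close>

lemma highest_root:
  assumes irr: "irreducible_root_system \<Phi>"
  shows "highest_root P \<in> P" and "\<And>\<beta>. \<beta> \<in> P \<Longrightarrow> root_le P \<beta> (highest_root P)"
proof -
  obtain \<beta>0 where b0: "\<beta>0 \<in> P" using pos_nonempty by auto
  obtain \<theta> where \<theta>: "root_le P \<beta>0 \<theta>" "\<And>\<psi>. root_le P \<theta> \<psi> \<Longrightarrow> \<theta> = \<psi>" "\<And>a. a \<in> \<Delta> \<Longrightarrow> \<theta> \<bullet> \<omega> a > 0"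
    using maximal_root_above[OF irr b0] by metis
  have \<theta>P: "\<theta> \<in> P" using \<theta>(1) root_le_iff by blast
  have top: "root_le P \<beta> \<theta>" if b: "\<beta> \<in> P" for \<beta>
  proof -
    obtain \<phi> where \<phi>: "root_le P \<beta> \<phi>" "\<And>\<psi>. root_le P \<phi> \<psi> \<Longrightarrow> \<phi> = \<psi>"
        "\<And>a. a \<in> \<Delta> \<Longrightarrow> \<phi> \<bullet> a \<ge> 0"
      using maximal_root_above[OF irr b] by metis
    have \<phi>P: "\<phi> \<in> P" using \<phi>(1) root_le_iff by blast
    have nn: "(\<theta> \<bullet> \<omega> a) * (a \<bullet> \<phi>) \<ge> 0" if "a \<in> \<Delta>" for a
      using \<theta>(3)[OF that] \<phi>(3)[OF that] by (simp add: inner_commute)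
    have "\<theta> \<bullet> \<phi> \<noteq> 0"
    proof
      assume "\<theta> \<bullet> \<phi> = 0"
      hence "\<forall>a\<in>\<Delta>. (\<theta> \<bullet> \<omega> a) * (a \<bullet> \<phi>) = 0"
        using nn finite_base by (subst (asm) inner_pos_root[OF \<theta>P], subst (asm) sum_nonneg_eq_0_iff) auto
      hence "\<forall>a\<in>\<Delta>. a \<bullet> \<phi> = 0" using \<theta>(3) by force
      hence "\<phi> \<bullet> \<phi> = 0" by (subst inner_pos_root[OF \<phi>P]) simp
      thus False using \<phi>P pos_root_root zero_not_root by auto
    qed
    moreover have "\<theta> \<bullet> \<phi> \<ge> 0" using nn by (subst inner_pos_root[OF \<theta>P]) (auto intro: sum_nonneg)
    ultimately have "\<theta> \<bullet> \<phi> > 0" by linarith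
    hence "\<theta> \<noteq> \<phi> \<Longrightarrow> \<theta> - \<phi> \<in> P \<or> \<phi> - \<theta> \<in> P" using pos_root_diff \<theta>P \<phi>P by blast
    hence "\<theta> = \<phi>" using root_le_diff \<theta>(2) \<phi>(2) \<theta>P \<phi>P by blast
    thus ?thesis using \<phi>(1) by simp
  qed
  have "highest_root P = \<theta>" unfolding highest_root_def
    using \<theta>P top \<theta>(2) by (intro the_equality) auto
  thus "highest_root P \<in> P" "\<And>\<beta>. \<beta> \<in> P \<Longrightarrow> root_le P \<beta> (highest_root P)" using \<theta>P top by auto
qed

lemma fund_alcove_less_1:
  assumes irr: "irreducible_root_system \<Phi>" and x: "x \<in> fund_alcove \<Phi> \<Delta>" and b: "\<beta> \<in> P"
  shows "\<beta> \<bullet> x < 1"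
proof -
  note h = highest_root[OF irr]
  have "\<beta> \<bullet> x \<le> highest_root P \<bullet> x"
    unfolding inner_pos_root[OF b, of x] inner_pos_root[OF h(1), of x]
  proof (intro sum_mono mult_right_mono)
    fix a assume "a \<in> \<Delta>"
    thus "\<beta> \<bullet> \<omega> a \<le> highest_root P \<bullet> \<omega> a" "0 \<le> a \<bullet> x"
      using h(2)[OF b] x by (auto simp: root_le_iff fund_alcove_def less_imp_le)
  qed
  also have "\<dots> < 1" using x by (simp add: fund_alcove_def)
  finally show ?thesis .
qed

lemma fund_alcove_nonempty:
  assumes irr: "irreducible_root_system \<Phi>"
  shows "fund_alcove \<Phi> \<Delta> \<noteq> {}"
proof -
  let ?h = "highest_root P \<bullet> \<rho>"
  have h: "?h > 0" using highest_root(1)[OF irr] height_pos by blast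
  \<comment> \<open>The divisor is the height of the highest root plus one, the Coxeter number; any
    larger value would do as well.\<close>
  have "(1 / (?h + 1)) *\<^sub>R \<rho> \<in> fund_alcove \<Phi> \<Delta>"
    using h base_pos height_pos by (auto simp: fund_alcove_def)
  thus ?thesis by blast
qed

end

section \<open>Geometric chains of filters\<close>

lemma inner_sum_mset_nonpos:
  fixes f g :: "'b \<Rightarrow> 'a::real_inner"
  assumes "\<And>a b. a \<in># A \<Longrightarrow> b \<in># B \<Longrightarrow> f a \<bullet> g b \<le> 0"
  shows "(\<Sum>a\<in>#A. f a) \<bullet> (\<Sum>b\<in>#B. g b) \<le> 0"
proof -
  have 1: "(\<Sum>a\<in>#A. f a) \<bullet> g b \<le> 0" if "b \<in># B" for b
    using assms that by (induction A) (auto simp: inner_add_left intro: add_nonpos_nonpos)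
  show ?thesis using 1 by (induction B) (auto simp: inner_add_right intro: add_nonpos_nonpos)
qed

locale filter_chain = based_root_system +
  fixes m :: nat and I :: "nat \<Rightarrow> 'a set"
  assumes m1: "m \<ge> 1" and geo: "geometric_chain P m I"
begin

lemma chain_0: "I 0 = P" and chain_beyond: "r > m \<Longrightarrow> I r = I m"
  using geo by (auto simp: geometric_chain_def)

lemma chain_antimono: "r \<le> s \<Longrightarrow> I s \<subseteq> I r"
proof (rule lift_Suc_antimono_le)
  fix n show "I (Suc n) \<subseteq> I n"
    using geo chain_beyond[of n] chain_beyond[of "Suc n"] unfolding geometric_chain_def
    by (metis Suc_lessD linorder_neqE_nat subset_refl lessI)
qed

lemma chain_sub: "I r \<subseteq> P"
  using chain_antimono[of 0 r] chain_0 by simp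

lemma chain_add: "\<beta> \<in> I r \<Longrightarrow> \<gamma> \<in> I s \<Longrightarrow> \<beta> + \<gamma> \<in> P \<Longrightarrow> \<beta> + \<gamma> \<in> I (r + s)"
proof -
  assume *: "\<beta> \<in> I r" "\<gamma> \<in> I s" "\<beta> + \<gamma> \<in> P"
  have "setsum (I r) (I s) \<inter> P \<subseteq> I (r + s)" using geo unfolding geometric_chain_def by blast
  moreover have "\<beta> + \<gamma> \<in> setsum (I r) (I s)" using * unfolding setsum_def by blast
  ultimately show ?thesis using * by blast
qed

lemma chain_compl_add:
  "\<beta> \<in> P - I r \<Longrightarrow> \<gamma> \<in> P - I s \<Longrightarrow> \<beta> + \<gamma> \<in> P \<Longrightarrow> r + s \<le> m \<Longrightarrow> \<beta> + \<gamma> \<notin> I (r + s)"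
proof -
  assume *: "\<beta> \<in> P - I r" "\<gamma> \<in> P - I s" "\<beta> + \<gamma> \<in> P" "r + s \<le> m"
  have "setsum (P - I r) (P - I s) \<inter> P \<subseteq> P - I (r + s)"
    using geo * unfolding geometric_chain_def by blast
  moreover have "\<beta> + \<gamma> \<in> setsum (P - I r) (P - I s)" using * unfolding setsum_def by blast
  ultimately show ?thesis using * by blast
qed

abbreviation "indec \<equiv> {\<alpha>. indecomposable P m I \<alpha>}"

lemma indec_sub: "indec \<subseteq> I m"
  by (auto simp: indecomposable_def)

lemma indec_sum: "\<beta> + \<gamma> \<in> indec \<Longrightarrow> r + s = m \<Longrightarrow> \<beta> \<in> I r \<Longrightarrow> \<gamma> \<notin> I s"
  by (auto simp: indecomposable_def)

text \<open>If the inner product were positive, one of the two roots would be the other, a member of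
  \<open>I m\<close>, plus a positive root, a member of \<open>I 0\<close>. Indecomposability
  forbids this for the levels \<open>m\<close> and 0.\<close>

lemma indec_obtuse:
  assumes "\<alpha> \<in> indec" "\<beta> \<in> indec" "\<alpha> \<noteq> \<beta>" shows "\<alpha> \<bullet> \<beta> \<le> 0"
proof (rule ccontr)
  have *: "x - y \<notin> P" if "x \<in> indec" "y \<in> indec" for x y
    using indec_sum[of y "x - y" m 0] that indec_sub chain_0 by auto
  have "\<alpha> \<in> P" "\<beta> \<in> P" using assms(1,2) indec_sub chain_sub by blast+
  moreover assume "\<not> \<alpha> \<bullet> \<beta> \<le> 0"
  ultimately have "\<alpha> - \<beta> \<in> P \<or> \<beta> - \<alpha> \<in> P" using pos_root_diff[of \<alpha> \<beta>] assms(3) by linarith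
  thus False using *[OF assms(1,2)] *[OF assms(2,1)] by blast
qed

lemma independent_indec: "T \<subseteq> indec \<Longrightarrow> independent T"
proof -
  assume T: "T \<subseteq> indec"
  hence TP: "T \<subseteq> P" using indec_sub chain_sub by blast
  show ?thesis
  proof (rule independent_if_obtuse)
    show "finite T" using TP finite_pos finite_subset by blast
    show "a \<bullet> \<rho> > 0" if "a \<in> T" for a using TP that height_pos by blast
  qed (use T indec_obtuse in blast)
qed

text \<open>A pair \<open>(a, r)\<close> in \<open>A\<close> stands for \<open>a \<bullet> x > r\<close> and a pair \<open>(b, s)\<close> in \<open>B\<close> for \<open>b \<bullet> x < s\<close>
  (both for \<open>a \<bullet> x = m\<close> if they lie in \<open>T \<times> {m}\<close>): no nonnegative integer combination of these
  conditions is contradictory. The induction replaces some \<open>a \<in> A\<close>, \<open>b \<in> B\<close> with positive inner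
  product by their difference.\<close>

lemma level_sum_less:
  fixes A B :: "('a \<times> nat) multiset"
  assumes T: "T \<subseteq> indec"
    and "\<And>a r. (a, r) \<in># A \<Longrightarrow> r \<le> m \<and> a \<in> I r"
    and "\<And>b s. (b, s) \<in># B \<Longrightarrow> s \<le> m \<and> b \<in> P \<and> (b \<notin> I s \<or> b \<in> T \<and> s = m)"
    and "(\<Sum>p\<in>#A. fst p) = (\<Sum>p\<in>#B. fst p)"
  shows "(\<Sum>p\<in>#A. snd p) < (\<Sum>p\<in>#B. snd p) \<or> A = B \<and> set_mset A \<subseteq> T \<times> {m}"
  using assms(2-4)
proof (induction "size A + size B" arbitrary: A B rule: less_induct)
  case less
  have TI: "T \<subseteq> I m" using T indec_sub by blast
  have PA: "fst p \<in> P" if "p \<in># A" for p using less.prems(1)[of "fst p" "snd p"] chain_sub that by auto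
  have PB: "fst p \<in> P" if "p \<in># B" for p using less.prems(2)[of "fst p" "snd p"] that by auto
  \<comment> \<open>Heights of positive roots are positive, so only an empty multiset of them sums
    to 0.\<close>
  have empty: "C = {#}" if C: "\<And>p. p \<in># C \<Longrightarrow> fst p \<in> P" "(\<Sum>p\<in>#C. fst p) = 0" for C :: "('a \<times> nat) multiset"
  proof (cases C)
    case (add p C')
    have "0 \<le> (\<Sum>p\<in>#D. fst p) \<bullet> \<rho>" if "\<And>p. p \<in># D \<Longrightarrow> fst p \<in> P" for D :: "('a \<times> nat) multiset"
      using that
    proof (induction D)
      case (add q D)
      hence "fst q \<bullet> \<rho> > 0" "0 \<le> (\<Sum>p\<in>#D. fst p) \<bullet> \<rho>" using height_pos by auto
      thus ?case by (simp add: inner_add_left)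
    qed simp
    from this[of C'] have "0 \<le> (\<Sum>p\<in>#C'. fst p) \<bullet> \<rho>" using C(1) add by auto
    moreover have "fst p \<bullet> \<rho> > 0" using C(1) add height_pos by auto
    ultimately have "(\<Sum>p\<in>#C. fst p) \<bullet> \<rho> > 0" by (simp add: add inner_add_left)
    thus ?thesis using C(2) by simp
  qed auto
  show ?case
  proof (cases "(\<Sum>p\<in>#A. fst p) = 0")
    case True
    hence "A = {#}" "B = {#}" using empty[of A] empty[of B] PA PB less.prems(3) by auto
    thus ?thesis by simp
  next
    case False
    \<comment> \<open>Both sums are the same nonzero vector, so some root of \<open>A\<close> and
      some root of \<open>B\<close> form an acute angle.\<close>
    hence "(\<Sum>p\<in>#A. fst p) \<bullet> (\<Sum>p\<in>#B. fst p) > 0" using less.prems(3) by simp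
    hence "\<exists>p q. p \<in># A \<and> q \<in># B \<and> fst p \<bullet> fst q > 0"
      using inner_sum_mset_nonpos[of A B fst fst] by (meson not_less)
    then obtain a r b s where ab: "(a, r) \<in># A" "(b, s) \<in># B" "a \<bullet> b > 0" by auto
    obtain A' B' where A': "A = add_mset (a, r) A'" and B': "B = add_mset (b, s) B'"
      using ab by (meson multi_member_split)
    have a: "r \<le> m" "a \<in> I r" "a \<in> P" using less.prems(1)[OF ab(1)] chain_sub by auto
    have b: "s \<le> m" "b \<in> P" "b \<notin> I s \<or> b \<in> T \<and> s = m" using less.prems(2)[OF ab(2)] by auto
    \<comment> \<open>No positive root lies outside \<open>I 0\<close>, so an upper bound never has
      level 0; this makes \<open>r - s\<close> smaller than \<open>m\<close> below.\<close>
    have s0: "s > 0" using b m1 chain_0 by (cases "s = 0") auto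
    have prA: "r' \<le> m \<and> x \<in> I r'" if "(x, r') \<in># A'" for x r' using less.prems(1)[of x r'] that A' by auto
    have prB: "s' \<le> m \<and> y \<in> P \<and> (y \<notin> I s' \<or> y \<in> T \<and> s' = m)" if "(y, s') \<in># B'" for y s'
      using less.prems(2)[of y s'] that B' by auto
    consider "a = b" | "a - b \<in> P" | "b - a \<in> P" using pos_root_diff[OF a(3) b(2) ab(3)] by blast
    thus ?thesis
    proof cases
      case 1
      have IH: "(\<Sum>p\<in>#A'. snd p) < (\<Sum>p\<in>#B'. snd p) \<or> A' = B' \<and> set_mset A' \<subseteq> T \<times> {m}"
        by (rule less.hyps) (use prA prB less.prems(3) 1 A' B' in auto)
      show ?thesis
      proof (cases "b \<notin> I s")
        case True
        hence "r < s" using a 1 chain_antimono[of s r] by (meson not_less subsetD)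
        thus ?thesis using IH A' B' by auto
      next
        case False
        hence bT: "b \<in> T" "s = m" using b by auto
        show ?thesis using IH A' B' 1 bT a(1) by (cases "r = m") auto
      qed
    next
      case 2
      define g where "g = a - b"
      have g: "g \<in> P" "a = b + g" using 2 by (auto simp: g_def)
      \<comment> \<open>The bound \<open>r \<le> s + r'\<close> keeps the comparison of levels;
        \<open>r' < m\<close> puts the new pair outside \<open>T \<times> {m}\<close>, so the
        induction hypothesis yields its strict alternative.\<close>
      have "\<exists>r'. r' < m \<and> g \<in> I r' \<and> r \<le> s + r'"
      proof (cases "b \<notin> I s")
        case True
        show ?thesis
        proof (cases "s \<le> r")
          case True
          have "g \<in> I (r - s)"
            using chain_compl_add[of b s g "r - s"] True g a b \<open>b \<notin> I s\<close> by auto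
          thus ?thesis using True s0 a by (intro exI[of _ "r - s"]) auto
        next
          case False
          thus ?thesis using g chain_0 m1 by (intro exI[of _ 0]) auto
        qed
      next
        case False
        thus ?thesis using g chain_0 m1 a b by (intro exI[of _ 0]) auto
      qed
      then obtain r' where r': "r' < m" "g \<in> I r'" "r \<le> s + r'" by blast
      have "(\<Sum>p\<in>#add_mset (g, r') A'. snd p) < (\<Sum>p\<in>#B'. snd p) \<or>
          add_mset (g, r') A' = B' \<and> set_mset (add_mset (g, r') A') \<subseteq> T \<times> {m}"
        by (rule less.hyps) (use prA prB less.prems(3) A' B' g r' in \<open>auto simp: algebra_simps\<close>)
      thus ?thesis using r' A' B' by auto
    next
      case 3
      define g where "g = b - a"
      have g: "g \<in> P" "b = a + g" using 3 by (auto simp: g_def)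
      have rs: "r < s \<and> g \<notin> I (s - r)"
      proof (cases "b \<notin> I s")
        case True
        have "b \<in> I (r + 0)" using chain_add[of a r g 0] a g b chain_0 by auto
        hence rs: "r < s" using True chain_antimono[of s r] by (metis add.right_neutral not_less subsetD)
        moreover have "g \<notin> I (s - r)" using chain_add[of a r g "s - r"] a g b True rs by auto
        ultimately show ?thesis by blast
      next
        case False
        hence bT: "b \<in> T" "s = m" using b by auto
        hence "g \<notin> I (s - r)" using indec_sum[of a g r "m - r"] T a g by auto
        moreover from this have "r \<noteq> s" using g chain_0 by auto
        ultimately show ?thesis using a bT by auto
      qed
      have "(\<Sum>p\<in>#A'. snd p) < (\<Sum>p\<in>#add_mset (g, s - r) B'. snd p) \<or>
          A' = add_mset (g, s - r) B' \<and> set_mset A' \<subseteq> T \<times> {m}"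
        by (rule less.hyps) (use prA prB less.prems(3) A' B' g rs b in \<open>auto simp: algebra_simps\<close>)
      \<comment> \<open>A root of \<open>T\<close> lies in \<open>I m\<close>, whereas
        \<open>g\<close> is outside \<open>I (s - r)\<close>; so the new pair is not tight.\<close>
      moreover have "\<not> (A' = add_mset (g, s - r) B' \<and> set_mset A' \<subseteq> T \<times> {m})"
      proof
        assume "A' = add_mset (g, s - r) B' \<and> set_mset A' \<subseteq> T \<times> {m}"
        hence "(g, s - r) \<in> T \<times> {m}" by auto
        thus False using TI rs by auto
      qed
      ultimately show ?thesis using rs A' B' by auto
    qed
  qed
qed

end

section \<open>Solvability of the inequalities of a chain\<close>

text \<open>Dirichlet approximation finds a multiple of \<open>u\<close> close to an integer vector
  \<open>p\<close>. Each equation evaluated at \<open>p\<close> is an integer of absolute value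
  below 1, so it holds exactly.\<close>

lemma integer_solution_near_multiple:
  fixes u :: "'i \<Rightarrow> real" and c :: "'j \<Rightarrow> 'i \<Rightarrow> real"
  assumes fin: "finite S" "finite J" and \<epsilon>: "\<epsilon> > 0"
    and int: "\<And>i j. i \<in> S \<Longrightarrow> j \<in> J \<Longrightarrow> c j i \<in> \<int>"
    and sol: "\<And>j. j \<in> J \<Longrightarrow> (\<Sum>i\<in>S. u i * c j i) = 0"
  obtains q :: int and p :: "'i \<Rightarrow> int" where "q > 0"
    "\<And>i. i \<in> S \<Longrightarrow> \<bar>of_int q * u i - of_int (p i)\<bar> < \<epsilon>"
    "\<And>j. j \<in> J \<Longrightarrow> (\<Sum>i\<in>S. of_int (p i) * c j i) = 0"
proof -
  define M where "M = (\<Sum>j\<in>J. \<Sum>i\<in>S. \<bar>c j i\<bar>)"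
  have M0: "M \<ge> 0" unfolding M_def by (intro sum_nonneg) auto
  \<comment> \<open>\<open>1 / \<epsilon>\<close> provides the closeness; \<open>M\<close>, the sum
    of all absolute coefficients, controls the error of every equation at once.\<close>
  obtain N :: nat where N: "real N > max (1 / \<epsilon>) (M + 1)" using reals_Archimedean2 by blast
  hence N0: "N > 0" using M0 by (cases N) auto
  obtain f where f: "bij_betw f {0..<card S} S" using ex_bij_betw_nat_finite[OF fin(1)] by blast
  obtain q p' where q: "(q::int) > 0"
    and p': "\<And>i. i < card S \<Longrightarrow> \<bar>of_int q * u (f i) - of_int (p' i)\<bar> < 1 / real N"
    using Dirichlet_approx_simult[OF N0, of "card S" "u \<circ> f"] by (metis comp_apply)
  define p where "p = p' \<circ> inv_into {0..<card S} f"
  have close: "\<bar>of_int q * u i - of_int (p i)\<bar> < 1 / real N" if i: "i \<in> S" for i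
  proof -
    have "i \<in> f ` {0..<card S}" using f i by (simp add: bij_betw_def)
    then obtain k where k: "k < card S" "f k = i" by auto
    hence "inv_into {0..<card S} f i = k" using f by (auto simp: bij_betw_def intro: inv_into_f_eq)
    thus ?thesis using p'[OF k(1)] k by (simp add: p_def)
  qed
  have "1 / real N < \<epsilon>" using N \<epsilon> N0 by (simp add: field_simps)
  hence "\<And>i. i \<in> S \<Longrightarrow> \<bar>of_int q * u i - of_int (p i)\<bar> < \<epsilon>" using close by fastforce
  moreover have "(\<Sum>i\<in>S. of_int (p i) * c j i) = 0" if j: "j \<in> J" for j
  proof -
    have "(\<Sum>i\<in>S. of_int (p i) * c j i) = (\<Sum>i\<in>S. of_int (p i) * c j i) - of_int q * (\<Sum>i\<in>S. u i * c j i)"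
      using sol[OF j] by simp
    also have "\<dots> = (\<Sum>i\<in>S. (of_int (p i) - of_int q * u i) * c j i)"
      by (simp add: sum_distrib_left sum_subtractf algebra_simps)
    finally have "\<bar>\<Sum>i\<in>S. of_int (p i) * c j i\<bar> \<le> (\<Sum>i\<in>S. \<bar>(of_int (p i) - of_int q * u i) * c j i\<bar>)"
      by (metis sum_abs)
    also have "\<dots> \<le> (\<Sum>i\<in>S. 1 / real N * \<bar>c j i\<bar>)"
      unfolding abs_mult
      using close by (intro sum_mono mult_right_mono) (auto simp: abs_minus_commute less_imp_le)
    also have "\<dots> = (\<Sum>i\<in>S. \<bar>c j i\<bar>) / real N" by (simp add: sum_divide_distrib)
    also have "\<dots> \<le> M / real N" unfolding M_def using j fin
      by (intro divide_right_mono member_le_sum[of j J "\<lambda>j. \<Sum>i\<in>S. \<bar>c j i\<bar>"]) (auto intro: sum_nonneg)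
    also have "\<dots> < 1" using N N0 by (simp add: field_simps)
    finally have "\<bar>\<Sum>i\<in>S. of_int (p i) * c j i\<bar> < 1" .
    moreover have "(\<Sum>i\<in>S. of_int (p i) * c j i) \<in> \<int>" using int j by (intro Ints_sum Ints_mult) auto
    ultimately show ?thesis by (metis Ints_nonzero_abs_less1)
  qed
  ultimately show ?thesis using that q by blast
qed

text \<open>Simultaneous Diophantine approximation makes the real multipliers integral.\<close>

lemma motzkin_transposition_int:
  fixes S E J :: "'b::euclidean_space set"
  assumes fin: "finite S" "finite E" "finite J" and S: "S \<noteq> {}" and disj: "S \<inter> E = {}"
    and int: "\<And>v j. v \<in> S \<union> E \<Longrightarrow> j \<in> J \<Longrightarrow> v \<bullet> j \<in> \<int>"
    and total: "\<And>v. (\<And>j. j \<in> J \<Longrightarrow> v \<bullet> j = 0) \<Longrightarrow> v = 0"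
    and infeasible: "\<nexists>z. (\<forall>s\<in>S. s \<bullet> z > 0) \<and> (\<forall>e\<in>E. e \<bullet> z = 0)"
  obtains p :: "'b \<Rightarrow> int" where "(\<Sum>v\<in>S \<union> E. of_int (p v) *\<^sub>R v) = 0"
    "\<And>v. v \<in> S \<Longrightarrow> p v \<ge> 0" "\<exists>v\<in>S. p v > 0"
proof -
  \<comment> \<open>Otherwise a strictly separating functional is bounded on one side on the
    subspace, hence vanishes there, and its negative solves the system. A common point is then a
    linear relation with nonnegative multipliers on \<open>S\<close>.\<close>
  have "convex hull S \<inter> span E \<noteq> {}"
  proof
    assume "convex hull S \<inter> span E = {}"
    moreover have "compact (convex hull S)" using fin by (simp add: finite_imp_compact compact_convex_hull)
    moreover have "convex (span E)" by (simp add: subspace_imp_convex)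
    ultimately obtain a b where ab: "\<forall>x\<in>convex hull S. a \<bullet> x < b" "\<forall>x\<in>span E. a \<bullet> x > b"
      using separating_hyperplane_compact_closed[of "convex hull S" "span E"] S by (auto simp: closed_span)
    have b0: "b < 0" using ab(2)[rule_format, OF span_zero] by simp
    have "a \<bullet> e = 0" if e: "e \<in> E" for e
    proof (rule ccontr)
      assume ne: "a \<bullet> e \<noteq> 0"
      have "(b / (a \<bullet> e)) *\<^sub>R e \<in> span E" using e by (intro span_mul span_base)
      thus False using ab(2) ne by force
    qed
    moreover have "a \<bullet> s < 0" if "s \<in> S" for s
      using ab(1) b0 hull_inc[OF that, of convex] by force
    ultimately have "(\<forall>s\<in>S. s \<bullet> (- a) > 0) \<and> (\<forall>e\<in>E. e \<bullet> (- a) = 0)"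
      by (auto simp: inner_commute)
    thus False using infeasible by blast
  qed
  then obtain y where y: "y \<in> convex hull S" "y \<in> span E" by blast
  from y(1) obtain u where u: "\<forall>x\<in>S. 0 \<le> u x" "sum u S = 1" "(\<Sum>x\<in>S. u x *\<^sub>R x) = y"
    using convex_hull_finite[OF fin(1)] by auto
  from y(2) obtain w where w: "(\<Sum>x\<in>E. w x *\<^sub>R x) = y" using span_finite[OF fin(2)] by auto
  define t where "t v = (if v \<in> S then u v else - w v)" for v
  have "(\<Sum>v\<in>E. t v *\<^sub>R v) = (\<Sum>v\<in>E. - (w v *\<^sub>R v))" using disj by (intro sum.cong) (auto simp: t_def)
  moreover have "(\<Sum>v\<in>S. t v *\<^sub>R v) = (\<Sum>v\<in>S. u v *\<^sub>R v)" by (intro sum.cong) (auto simp: t_def)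
  ultimately have t: "(\<Sum>v\<in>S \<union> E. t v *\<^sub>R v) = 0"
    using u(3) w by (simp add: sum.union_disjoint[OF fin(1,2) disj] sum_negf)
  have tj: "(\<Sum>v\<in>S \<union> E. t v * (v \<bullet> j)) = 0" for j
    using arg_cong[OF t, of "\<lambda>x. x \<bullet> j"] by (simp add: inner_sum_left)
  \<comment> \<open>An error below 1 keeps integers near nonnegative reals nonnegative. An error
    below \<open>1 / card S\<close> prevents all of them from vanishing on \<open>S\<close>, where
    the multiples \<open>q * t v\<close> sum to \<open>q \<ge> 1\<close>.\<close>
  define \<epsilon> where "\<epsilon> = 1 / real (card S + 1)"
  have \<epsilon>: "\<epsilon> > 0" "\<epsilon> \<le> 1" by (auto simp: \<epsilon>_def)
  obtain q :: int and p :: "'b \<Rightarrow> int" where q: "q > 0"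
    and close: "\<And>v. v \<in> S \<union> E \<Longrightarrow> \<bar>of_int q * t v - of_int (p v)\<bar> < \<epsilon>"
    and sol: "\<And>j. j \<in> J \<Longrightarrow> (\<Sum>v\<in>S \<union> E. of_int (p v) * (v \<bullet> j)) = 0"
    using integer_solution_near_multiple[of "S \<union> E" J \<epsilon> "\<lambda>j v. v \<bullet> j" t] fin \<epsilon>(1) int tj by blast
  have "(\<Sum>v\<in>S \<union> E. of_int (p v) *\<^sub>R v) = 0"
    using sol by (intro total) (simp add: inner_sum_left)
  moreover have nn: "p v \<ge> 0" if v: "v \<in> S" for v
  proof -
    have "of_int q * t v \<ge> 0" using q u(1) v by (simp add: t_def)
    hence "real_of_int (p v) > -1" using close[of v] v \<epsilon> by simp
    thus ?thesis by linarith
  qed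
  moreover have "\<exists>v\<in>S. p v > 0"
  proof (rule ccontr)
    assume "\<not> (\<exists>v\<in>S. p v > 0)"
    hence p0: "p v = 0" if "v \<in> S" for v using nn[OF that] that by force
    have "of_int q * t v \<le> \<epsilon>" if "v \<in> S" for v using close[of v] p0[OF that] that by simp
    hence "(\<Sum>v\<in>S. of_int q * t v) \<le> real (card S) * \<epsilon>" using sum_bounded_above[of S "\<lambda>v. of_int q * t v"] by simp
    moreover have "(\<Sum>v\<in>S. of_int q * t v) = of_int q"
    proof -
      have "(\<Sum>v\<in>S. t v) = (\<Sum>v\<in>S. u v)" by (intro sum.cong) (auto simp: t_def)
      thus ?thesis using u(2) by (simp flip: sum_distrib_left)
    qed
    moreover have "real (card S) * \<epsilon> < 1" by (simp add: \<epsilon>_def field_simps)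
    moreover have "real_of_int q \<ge> 1" using q by simp
    ultimately show False by linarith
  qed
  ultimately show ?thesis using that by blast
qed

text \<open>For \<open>T = {}\<close> this is the open region of the chain. A root of
  \<open>T\<close> keeps its strict bounds below level \<open>m\<close>, and its bound at level
  \<open>m\<close> becomes an equation.\<close>

definition chain_face :: "'a::euclidean_space set \<Rightarrow> nat \<Rightarrow> (nat \<Rightarrow> 'a set) \<Rightarrow> 'a set \<Rightarrow> 'a set" where
  "chain_face P m I T = {x. (\<forall>\<alpha>\<in>P. \<forall>r\<le>m.
      (\<alpha> \<in> I r \<and> \<not> (\<alpha> \<in> T \<and> r = m) \<longrightarrow> \<alpha> \<bullet> x > real r) \<and> (\<alpha> \<notin> I r \<longrightarrow> \<alpha> \<bullet> x < real r)) \<and>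
      (\<forall>\<alpha>\<in>T. \<alpha> \<bullet> x = real m)}"

text \<open>Multisets with prescribed multiplicities encode nonnegative integer combinations, the
  form that \<open>level_sum_less\<close> requires.\<close>

lemma sum_replicate_mset:
  fixes f :: "'b \<Rightarrow> 'c::real_vector"
  assumes "finite X"
  shows "(\<Sum>x\<in>#(\<Sum>x\<in>X. replicate_mset (n x) x). f x) = (\<Sum>x\<in>X. real (n x) *\<^sub>R f x)"
  using assms
proof (induction X)
  case (insert x X)
  have "(\<Sum>y\<in>#replicate_mset k x. f y) = real k *\<^sub>R f x" for k
    by (induction k) (auto simp: scaleR_add_left)
  thus ?case using insert by simp
qed simp

lemma mem_sum_replicate_mset:
  "finite X \<Longrightarrow> y \<in># (\<Sum>x\<in>X. replicate_mset (n x) x) \<longleftrightarrow> y \<in> X \<and> n y > 0"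
  by (induction X rule: finite_induct) auto

context based_root_system
begin

lemma coords_zero: "(\<And>a. a \<in> \<Delta> \<Longrightarrow> x \<bullet> \<omega> a = 0) \<Longrightarrow> x = 0"
proof -
  assume z: "\<And>a. a \<in> \<Delta> \<Longrightarrow> x \<bullet> \<omega> a = 0"
  have "\<Phi> \<subseteq> span \<Delta>"
  proof
    fix \<beta> assume "\<beta> \<in> \<Phi>"
    thus "\<beta> \<in> span \<Delta>" by (subst root_coords(1)) (auto intro: span_sum span_mul span_base)
  qed
  hence "span \<Delta> = UNIV" using crys span_minimal[of \<Phi> "span \<Delta>"] by (auto simp: crystallographic_root_system_def)
  then obtain c where c: "x = (\<Sum>a\<in>\<Delta>. c a *\<^sub>R a)" using span_finite[OF finite_base] by blast
  hence "\<And>a. a \<in> \<Delta> \<Longrightarrow> c a = 0" using z coord_sum by metis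
  thus ?thesis using c by simp
qed

end

section \<open>Existence of points on the face of every pair\<close>

context filter_chain
begin

text \<open>An obstruction to the homogenised system is an integer relation; sorted by sign it gives
  multisets \<open>A\<close> and \<open>B\<close> with equal root sums, and the levels of
  \<open>A\<close> sum to at least those of \<open>B\<close>. By \<open>level_sum_less\<close> only
  tight pairs remain, while some strict condition has a positive multiplier.\<close>

lemma chain_face_nonempty:
  assumes T: "T \<subseteq> indec"
  shows "chain_face P m I T \<noteq> {}"
proof
  assume empty: "chain_face P m I T = {}"
  \<comment> \<open>Homogenisation: \<open>g (a, r) \<bullet> (x, t)\<close> is
    \<open>a \<bullet> x - r * t\<close>. The vector \<open>(0, 1)\<close> in \<open>S\<close>
    imposes \<open>t > 0\<close>, so a solution can be scaled to \<open>t = 1\<close>.\<close>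
  define g :: "'a \<times> nat \<Rightarrow> 'a \<times> real" where "g = (\<lambda>(a, r). (a, - real r))"
  define E0 where "E0 = T \<times> {m}"
  define L where "L = {(a, r). r \<le> m \<and> a \<in> I r}"
  define U where "U = {(b, s). s \<le> m \<and> b \<in> P \<and> b \<notin> I s}"
  define S where "S = insert (0, 1) (g ` (L - E0) \<union> (\<lambda>x. - g x) ` U)"
  \<comment> \<open>Test vectors with integral values on all constraint vectors; only 0 is
    orthogonal to all of them.\<close>
  define J where "J = insert (0, 1) ((\<lambda>a. (\<omega> a, 0 :: real)) ` \<Delta>)"
  have TI: "T \<subseteq> I m" using T indec_sub by blast
  have LP: "a \<in> P" if "(a, r) \<in> L" for a r using that chain_sub by (auto simp: L_def)
  have UP: "a \<in> P" if "(a, r) \<in> U" for a r using that by (auto simp: U_def)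
  have EL: "E0 \<subseteq> L" using TI by (auto simp: E0_def L_def)
  have EU: "E0 \<inter> U = {}" using TI by (auto simp: E0_def U_def)
  have "L \<subseteq> P \<times> {..m}" "U \<subseteq> P \<times> {..m}" using chain_sub by (auto simp: L_def U_def)
  hence fL: "finite L" and fU: "finite U" using finite_pos finite_subset by (meson finite_SigmaI finite_atMost)+
  have fE: "finite E0" using EL fL finite_subset by blast
  have injg: "inj_on g X" for X by (auto simp: inj_on_def g_def)
  have injg': "inj_on (\<lambda>x. - g x) X" for X by (auto simp: inj_on_def g_def)
  have gfst: "fst (g x) = fst x" for x by (cases x) (simp add: g_def)
  have LP': "fst x \<in> P" if "x \<in> L" for x using LP[of "fst x" "snd x"] that by simp
  have UP': "fst x \<in> P" if "x \<in> U" for x using UP[of "fst x" "snd x"] that by simp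
  have P0: "0 \<notin> P" using zero_not_root pos_root_root by blast
  have PN: "- b \<notin> P" if "b \<in> P" for b using height_pos[OF that] height_pos[of "- b"] by auto
  \<comment> \<open>Multipliers are attached to vectors, so constraints of different kinds must not
    share a vector. The first component decides most cases: 0 is no root and the negative of a
    positive root is not positive.\<close>
  have d1: "S \<inter> g ` E0 = {}"
  proof -
    have "g x \<noteq> (0, 1)" if "x \<in> E0" for x using that EL LP' P0 gfst[of x] by (metis fst_conv subsetD)
    moreover have "- g y \<noteq> g x" if "y \<in> U" "x \<in> E0" for x y
      using PN[OF UP'[OF that(1)]] that EL LP' gfst[of x] gfst[of y] by (metis fst_uminus subsetD)
    moreover have "g y \<noteq> g x" if "y \<in> L - E0" "x \<in> E0" for x y
      using that injg[of UNIV] by (auto dest: injD)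
    ultimately have "g x \<notin> S" if "x \<in> E0" for x using that unfolding S_def
      by (metis (no_types, lifting) UnE imageE insertE)
    thus ?thesis by blast
  qed
  have d2: "(0, 1) \<notin> g ` (L - E0) \<union> (\<lambda>x. - g x) ` U"
  proof -
    have "g x \<noteq> (0, 1)" if "x \<in> L" for x using that LP' P0 gfst[of x] by (metis fst_conv)
    moreover have "- g x \<noteq> (0, 1)" if "x \<in> U" for x
      using UP'[OF that] P0 gfst[of x] by (metis fst_conv fst_uminus neg_equal_0_iff_equal)
    ultimately show ?thesis by (metis (no_types, lifting) DiffD1 UnE imageE)
  qed
  have d3: "g ` (L - E0) \<inter> (\<lambda>x. - g x) ` U = {}"
  proof -
    have "- g y \<noteq> g x" if "y \<in> U" "x \<in> L" for x y
      using PN[OF UP'[OF that(1)]] LP'[OF that(2)] gfst[of x] gfst[of y] by (metis fst_uminus)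
    thus ?thesis by (intro equals0I) (metis (no_types, lifting) DiffD1 IntE imageE)
  qed
  have infeasible: "\<nexists>z. (\<forall>s\<in>S. s \<bullet> z > 0) \<and> (\<forall>e\<in>g ` E0. e \<bullet> z = 0)"
  proof
    assume "\<exists>z. (\<forall>s\<in>S. s \<bullet> z > 0) \<and> (\<forall>e\<in>g ` E0. e \<bullet> z = 0)"
    then obtain x t where z: "\<forall>s\<in>S. s \<bullet> (x, t) > 0" "\<forall>e\<in>g ` E0. e \<bullet> (x, t) = 0" by auto
    have t: "t > 0" using z(1) by (simp add: S_def)
    have lo: "a \<bullet> x > real r * t" if "(a, r) \<in> L" "(a, r) \<notin> E0" for a r
      using z(1) that by (force simp: S_def g_def)
    have up: "b \<bullet> x < real s * t" if "(b, s) \<in> U" for b s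
      using z(1) that by (force simp: S_def g_def)
    have eq: "a \<bullet> x = real m * t" if "a \<in> T" for a
      using z(2) that by (force simp: E0_def g_def)
    have "(1 / t) *\<^sub>R x \<in> chain_face P m I T"
      using t lo up eq unfolding chain_face_def by (auto simp: field_simps L_def U_def E0_def)
    thus False using empty by blast
  qed
  have fin: "finite S" "finite (g ` E0)" "finite J" "S \<noteq> {}"
    using fL fU fE finite_base by (auto simp: S_def J_def)
  have integral: "v \<bullet> j \<in> \<int>" if v: "v \<in> S \<union> g ` E0" and j: "j \<in> J" for v j
  proof -
    have "g (a, r) \<bullet> j \<in> \<int>" if "a \<in> P" for a r
      using j root_coords(2)[OF pos_root_root[OF that]] by (auto simp: J_def g_def)
    moreover have "(0, 1) \<bullet> j \<in> \<int>" using j by (auto simp: J_def)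
    ultimately have "g x \<bullet> j \<in> \<int>" if "x \<in> L \<union> U" for x
      using that LP' UP' by (cases x) (metis UnE fst_conv)
    thus ?thesis using v EL \<open>(0, 1) \<bullet> j \<in> \<int>\<close> unfolding S_def
      by (elim UnE insertE imageE) (auto simp: inner_minus_left)
  qed
  have total: "v = 0" if "\<And>j. j \<in> J \<Longrightarrow> v \<bullet> j = 0" for v :: "'a \<times> real"
  proof (cases v)
    case (Pair x t)
    have "x \<bullet> \<omega> a = 0" if "a \<in> \<Delta>" for a
      using \<open>\<And>j. j \<in> J \<Longrightarrow> v \<bullet> j = 0\<close>[of "(\<omega> a, 0)"] that Pair by (auto simp: J_def)
    hence "x = 0" by (rule coords_zero)
    moreover have "t = 0" using that[of "(0, 1)"] Pair by (auto simp: J_def)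
    ultimately show ?thesis using Pair by (simp add: zero_prod_def)
  qed
  obtain p :: "'a \<times> real \<Rightarrow> int" where p: "(\<Sum>v\<in>S \<union> g ` E0. of_int (p v) *\<^sub>R v) = 0"
    "\<And>v. v \<in> S \<Longrightarrow> p v \<ge> 0" "\<exists>v\<in>S. p v > 0"
    using motzkin_transposition_int[OF fin d1 integral total infeasible] by blast
  define nA where "nA x = nat (p (g x))" for x
  \<comment> \<open>The multiplier of an equation may have either sign: its positive part is counted
    in \<open>A\<close>, its negative part in \<open>B\<close>.\<close>
  define nB where "nB x = (if x \<in> E0 then nat (- p (g x)) else nat (p (- g x)))" for x
  define A where "A = (\<Sum>x\<in>L. replicate_mset (nA x) x)"
  define B where "B = (\<Sum>x\<in>U \<union> E0. replicate_mset (nB x) x)"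
  have A: "(\<Sum>x\<in>#A. g x) = (\<Sum>x\<in>L - E0. of_int (p (g x)) *\<^sub>R g x) + (\<Sum>x\<in>E0. real (nA x) *\<^sub>R g x)"
  proof -
    have "(\<Sum>x\<in>L - E0. real (nA x) *\<^sub>R g x) = (\<Sum>x\<in>L - E0. of_int (p (g x)) *\<^sub>R g x)"
      using p(2) by (intro sum.cong) (auto simp: nA_def S_def)
    thus ?thesis unfolding A_def sum_replicate_mset[OF fL]
      using sum.subset_diff[OF EL fL, of "\<lambda>x. real (nA x) *\<^sub>R g x"] by simp
  qed
  have B: "(\<Sum>x\<in>#B. g x) = (\<Sum>x\<in>U. of_int (p (- g x)) *\<^sub>R g x) + (\<Sum>x\<in>E0. real (nB x) *\<^sub>R g x)"
  proof -
    have "(\<Sum>x\<in>U. real (nB x) *\<^sub>R g x) = (\<Sum>x\<in>U. of_int (p (- g x)) *\<^sub>R g x)"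
      using p(2) EU by (intro sum.cong) (auto simp: nB_def S_def)
    thus ?thesis unfolding B_def using fU fE EU
      by (subst sum_replicate_mset) (auto simp: sum.union_disjoint Int_commute)
  qed
  have sumS: "(\<Sum>v\<in>S. of_int (p v) *\<^sub>R v) = of_int (p (0, 1)) *\<^sub>R (0, 1) +
      ((\<Sum>x\<in>L - E0. of_int (p (g x)) *\<^sub>R g x) - (\<Sum>x\<in>U. of_int (p (- g x)) *\<^sub>R g x))"
    unfolding S_def using fL fU d2 d3
    by (subst sum.insert; simp add: sum.union_disjoint sum.reindex[OF injg] sum.reindex[OF injg'] sum_negf)
  have sumE: "(\<Sum>v\<in>g ` E0. of_int (p v) *\<^sub>R v) = (\<Sum>x\<in>E0. real (nA x) *\<^sub>R g x) - (\<Sum>x\<in>E0. real (nB x) *\<^sub>R g x)"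
  proof -
    have "(\<Sum>v\<in>g ` E0. of_int (p v) *\<^sub>R v) = (\<Sum>x\<in>E0. of_int (p (g x)) *\<^sub>R g x)"
      by (simp add: sum.reindex[OF injg])
    also have "\<dots> = (\<Sum>x\<in>E0. (real (nA x) - real (nB x)) *\<^sub>R g x)"
      by (intro sum.cong) (auto simp: nA_def nB_def)
    finally show ?thesis by (simp add: scaleR_diff_left sum_subtractf)
  qed
  have "(\<Sum>v\<in>S \<union> g ` E0. of_int (p v) *\<^sub>R v) =
      (\<Sum>v\<in>S. of_int (p v) *\<^sub>R v) + (\<Sum>v\<in>g ` E0. of_int (p v) *\<^sub>R v)"
    using fin(1,2) d1 by (rule sum.union_disjoint)
  also have "\<dots> = (\<Sum>x\<in>#A. g x) + of_int (p (0, 1)) *\<^sub>R (0, 1) - (\<Sum>x\<in>#B. g x)"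
    unfolding A B sumS sumE by simp
  finally have eq: "(\<Sum>x\<in>#A. g x) + of_int (p (0, 1)) *\<^sub>R (0, 1) = (\<Sum>x\<in>#B. g x)"
    using p(1) by simp
  have sg: "(\<Sum>x\<in>#C. g x) = ((\<Sum>x\<in>#C. fst x), - real (\<Sum>x\<in>#C. snd x))" for C
    by (induction C) (auto simp: g_def zero_prod_def)
  have fst_eq: "(\<Sum>x\<in>#A. fst x) = (\<Sum>x\<in>#B. fst x)" and
    snd_eq: "real (\<Sum>x\<in>#A. snd x) = real (\<Sum>x\<in>#B. snd x) + of_int (p (0, 1))"
    using eq unfolding sg by auto
  have p01: "p (0, 1) \<ge> 0" using p(2) by (simp add: S_def)
  have memA: "x \<in># A \<longleftrightarrow> x \<in> L \<and> nA x > 0" for x unfolding A_def by (rule mem_sum_replicate_mset[OF fL])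
  have memB: "x \<in># B \<longleftrightarrow> x \<in> U \<union> E0 \<and> nB x > 0" for x
    unfolding B_def by (rule mem_sum_replicate_mset) (use fU fE in auto)
  have "(\<Sum>x\<in>#A. snd x) < (\<Sum>x\<in>#B. snd x) \<or> A = B \<and> set_mset A \<subseteq> T \<times> {m}"
  proof (rule level_sum_less[OF T])
    show "r \<le> m \<and> a \<in> I r" if "(a, r) \<in># A" for a r using that memA by (auto simp: L_def)
    show "s \<le> m \<and> b \<in> P \<and> (b \<notin> I s \<or> b \<in> T \<and> s = m)" if "(b, s) \<in># B" for b s
      using that memB[of "(b, s)"] TI chain_sub[of m] by (auto simp: U_def E0_def)
  qed (rule fst_eq)
  moreover have "\<not> (\<Sum>x\<in>#A. snd x) < (\<Sum>x\<in>#B. snd x)" using snd_eq p01 by linarith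
  ultimately have AB: "A = B" "set_mset A \<subseteq> E0" by (auto simp: E0_def)
  have "p (0, 1) = 0" using snd_eq AB(1) by simp
  moreover have "p (g x) \<le> 0" if "x \<in> L - E0" for x
    using AB(2) memA[of x] that by (auto simp: nA_def)
  moreover have "p (- g x) \<le> 0" if "x \<in> U" for x
  proof -
    have "x \<notin> E0" using that EU by auto
    thus ?thesis using AB memB[of x] that by (auto simp: nB_def)
  qed
  ultimately show False using p(3) by (fastforce simp: S_def)
qed

end

section \<open>Regions, walls and faces\<close>

text \<open>The \<open>else\<close> branch serves all levels from \<open>m\<close> on, as a chain is
  constant there.\<close>

definition chain_at :: "'a::euclidean_space set \<Rightarrow> nat \<Rightarrow> 'a \<Rightarrow> nat \<Rightarrow> 'a set" where
  "chain_at P m x r = (if r < m then {\<alpha>\<in>P. \<alpha> \<bullet> x > real r} else {\<alpha>\<in>P. \<alpha> \<bullet> x \<ge> real m})"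

definition tight_at :: "'a::euclidean_space set \<Rightarrow> nat \<Rightarrow> 'a \<Rightarrow> 'a set" where
  "tight_at P m x = {\<alpha>\<in>P. \<alpha> \<bullet> x = real m}"

text \<open>The finitely many strict inequalities form the open convex set \<open>U\<close>. The
  equations alone then determine the affine hull of a nonempty face.\<close>

lemma chain_face_decomp:
  fixes P T :: "'a::euclidean_space set"
  assumes "finite P"
  obtains U where "open U" "convex U" "chain_face P m I T = {x. \<forall>\<alpha>\<in>T. \<alpha> \<bullet> x = real m} \<inter> U"
proof -
  define V where "V p = (if fst p \<in> I (snd p) \<and> \<not> (fst p \<in> T \<and> snd p = m) then {x. fst p \<bullet> x > real (snd p)} else UNIV)
     \<inter> (if fst p \<notin> I (snd p) then {x. fst p \<bullet> x < real (snd p)} else UNIV)" for p :: "'a \<times> nat"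
  have "open (V p)" "convex (V p)" for p
    unfolding V_def by (auto intro!: open_Int convex_Int open_halfspace_gt open_halfspace_lt convex_halfspace_gt convex_halfspace_lt)
  hence "open (\<Inter>p\<in>P \<times> {..m}. V p)" "convex (\<Inter>p\<in>P \<times> {..m}. V p)"
    using assms by (auto intro!: open_INT convex_INT)
  moreover have "x \<in> V (\<alpha>, r) \<longleftrightarrow>
      (\<alpha> \<in> I r \<and> \<not> (\<alpha> \<in> T \<and> r = m) \<longrightarrow> \<alpha> \<bullet> x > real r) \<and> (\<alpha> \<notin> I r \<longrightarrow> \<alpha> \<bullet> x < real r)" for x \<alpha> r
    by (simp add: V_def)
  hence "chain_face P m I T = {x. \<forall>\<alpha>\<in>T. \<alpha> \<bullet> x = real m} \<inter> (\<Inter>p\<in>P \<times> {..m}. V p)"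
    unfolding chain_face_def by blast
  ultimately show ?thesis using that by blast
qed

lemma affine_intersection_hyp: "affine {x. \<forall>\<alpha>\<in>T. \<alpha> \<bullet> x = c}"
proof -
  have "{x. \<forall>\<alpha>\<in>T. \<alpha> \<bullet> x = c} = (\<Inter>\<alpha>\<in>T. {x. \<alpha> \<bullet> x = c})" by auto
  thus ?thesis by (auto intro!: affine_Inter affine_hyperplane)
qed

text \<open>The solution set is the translate by \<open>x\<close> of the orthogonal complement of
  \<open>span T\<close>.\<close>

lemma aff_dim_intersection_hyp:
  fixes T :: "'a::euclidean_space set"
  assumes "independent T" and x: "\<forall>\<alpha>\<in>T. \<alpha> \<bullet> x = c"
  shows "aff_dim {x. \<forall>\<alpha>\<in>T. \<alpha> \<bullet> x = c} = int (DIM('a)) - int (card T)"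
proof -
  let ?W = "{y \<in> UNIV. \<forall>a \<in> span T. orthogonal a y}"
  have "{x. \<forall>\<alpha>\<in>T. \<alpha> \<bullet> x = c} = (+) x ` ?W"
  proof (intro equalityI subsetI)
    fix y assume y: "y \<in> {x. \<forall>\<alpha>\<in>T. \<alpha> \<bullet> x = c}"
    have "orthogonal (y - x) a" if "a \<in> span T" for a
      by (rule orthogonal_to_span[OF that]) (use x y in \<open>auto simp: orthogonal_def inner_diff_left inner_diff_right inner_commute\<close>)
    hence "y - x \<in> ?W" by (auto simp: orthogonal_commute)
    thus "y \<in> (+) x ` ?W" by (intro image_eqI[of _ _ "y - x"]) auto
  next
    fix y assume "y \<in> (+) x ` ?W"
    thus "y \<in> {x. \<forall>\<alpha>\<in>T. \<alpha> \<bullet> x = c}" using x by (auto simp: orthogonal_def inner_add_right span_base)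
  qed
  hence "aff_dim {x. \<forall>\<alpha>\<in>T. \<alpha> \<bullet> x = c} = aff_dim ?W" by (simp add: aff_dim_translation_eq)
  also have "subspace ?W"
    unfolding subspace_def by (auto simp: orthogonal_def inner_add_right)
  hence "aff_dim ?W = int (dim ?W)" by (rule aff_dim_subspace)
  also have "dim ?W + dim (span T) = dim (UNIV :: 'a set)"
    by (rule dim_subspace_orthogonal_to_vectors) auto
  hence "int (dim ?W) = int (DIM('a)) - int (card T)"
    using dim_eq_card_independent[OF assms(1)] by simp
  finally show ?thesis .
qed

text \<open>Moving inside the first hyperplane along the component \<open>\<delta>\<close> of
  \<open>\<beta>\<close> orthogonal to \<open>\<alpha>\<close> does not change the value of
  \<open>\<beta>\<close>; so \<open>\<delta>\<close> is orthogonal to \<open>\<beta>\<close> and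
  hence to itself.\<close>

lemma hyp_subset_parallel:
  fixes \<alpha> \<beta> :: "'a::euclidean_space"
  assumes sub: "hyp \<alpha> c \<subseteq> hyp \<beta> d" and ne: "\<alpha> \<noteq> 0"
  shows "\<exists>t. \<beta> = t *\<^sub>R \<alpha>"
proof -
  define t where "t = (\<beta> \<bullet> \<alpha>) / (\<alpha> \<bullet> \<alpha>)"
  define \<delta> where "\<delta> = \<beta> - t *\<^sub>R \<alpha>"
  define y where "y = (c / (\<alpha> \<bullet> \<alpha>)) *\<^sub>R \<alpha>"
  have d: "\<alpha> \<bullet> \<delta> = 0" using ne by (simp add: \<delta>_def t_def inner_diff_right inner_commute)
  have "\<alpha> \<bullet> y = c" using ne by (simp add: y_def)
  hence "y \<in> hyp \<alpha> c" "y + \<delta> \<in> hyp \<alpha> c" using d by (auto simp: hyp_def inner_add_right)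
  hence "\<beta> \<bullet> y = d" "\<beta> \<bullet> (y + \<delta>) = d" using sub by (auto simp: hyp_def)
  hence "\<beta> \<bullet> \<delta> = 0" by (simp add: inner_add_right)
  hence "\<delta> \<bullet> \<delta> = 0" using d by (simp add: \<delta>_def inner_diff_left)
  thus ?thesis by (auto simp: \<delta>_def)
qed

section \<open>From points to geometric chains\<close>

context based_root_system
begin

lemma root_le_inner:
  assumes "root_le P \<alpha> \<beta>" "x \<in> dominant_cone P" shows "\<alpha> \<bullet> x \<le> \<beta> \<bullet> x"
proof -
  obtain c where c: "\<forall>\<gamma>\<in>P. c \<gamma> \<ge> 0" "\<beta> - \<alpha> = (\<Sum>\<gamma>\<in>P. c \<gamma> *\<^sub>R \<gamma>)"
    using assms(1) unfolding root_le_def by blast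
  have "(\<beta> - \<alpha>) \<bullet> x = (\<Sum>\<gamma>\<in>P. c \<gamma> * (\<gamma> \<bullet> x))" by (simp add: c(2) inner_sum_left)
  also have "\<dots> \<ge> 0" using c(1) assms(2)
    by (intro sum_nonneg mult_nonneg_nonneg) (auto simp: dominant_cone_def less_imp_le)
  finally show ?thesis by (simp add: inner_diff_left)
qed

lemma chain_at_geometric:
  assumes m: "m \<ge> 1" and x: "x \<in> dominant_cone P"
    and off: "\<And>\<alpha> r. \<alpha> \<in> P \<Longrightarrow> r < m \<Longrightarrow> \<alpha> \<bullet> x \<noteq> real r"
  shows "geometric_chain P m (chain_at P m x)"
    and "tight_at P m x \<subseteq> {\<alpha>. indecomposable P m (chain_at P m x) \<alpha>}"
    and "x \<in> chain_face P m (chain_at P m x) (tight_at P m x)"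
proof -
  let ?I = "chain_at P m x"
  \<comment> \<open>Membership in a filter beyond level \<open>m\<close> guarantees only the value
    \<open>m\<close>, hence the minimum.\<close>
  have lower: "\<beta> \<bullet> x \<ge> real (min i m)" if "\<beta> \<in> ?I i" for \<beta> i
    using that by (auto simp: chain_at_def split: if_splits)
  have lower': "\<beta> \<bullet> x > real i" if "\<beta> \<in> ?I i" "i < m" for \<beta> i
    using that by (auto simp: chain_at_def)
  have upper: "\<beta> \<bullet> x < real i" if "\<beta> \<in> P - ?I i" "i \<le> m" for \<beta> i
    using that off[of \<beta> i] by (cases "i < m") (auto simp: chain_at_def not_less not_le)
  have inP: "\<beta> \<in> P" if "\<beta> \<in> ?I i" for \<beta> i using that by (auto simp: chain_at_def split: if_splits)
  show "geometric_chain P m ?I" unfolding geometric_chain_def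
  proof (intro conjI allI impI)
    show "?I 0 = P" using m x by (auto simp: chain_at_def dominant_cone_def)
    show "is_filter P (?I i)" if "i \<le> m" for i
      using root_le_inner[OF _ x] unfolding is_filter_def chain_at_def
      by (auto split: if_splits intro: less_le_trans order_trans)
    show "?I (Suc i) \<subseteq> ?I i" if "i < m" for i
      using that by (auto simp: chain_at_def split: if_splits)
    show "?I i = ?I m" if "i > m" for i using that by (simp add: chain_at_def)
    show "setsum (P - ?I i) (P - ?I j) \<inter> P \<subseteq> P - ?I (i + j)" if ij: "i + j \<le> m" for i j
    proof
      fix y assume "y \<in> setsum (P - ?I i) (P - ?I j) \<inter> P"
      then obtain \<beta> \<gamma> where y: "y = \<beta> + \<gamma>" "\<beta> \<in> P - ?I i" "\<gamma> \<in> P - ?I j" "y \<in> P"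
        unfolding setsum_def by blast
      have "y \<bullet> x < real (i + j)" using upper[OF y(2)] upper[OF y(3)] ij by (simp add: y(1) inner_add_left)
      thus "y \<in> P - ?I (i + j)" using lower[of y "i + j"] ij y(4) by (auto simp: min_def)
    qed
    show "setsum (?I i) (?I j) \<inter> P \<subseteq> ?I (i + j)" for i j
    proof
      fix y assume "y \<in> setsum (?I i) (?I j) \<inter> P"
      then obtain \<beta> \<gamma> where y: "y = \<beta> + \<gamma>" "\<beta> \<in> ?I i" "\<gamma> \<in> ?I j" "y \<in> P"
        unfolding setsum_def by blast
      show "y \<in> ?I (i + j)"
      proof (cases "i + j < m")
        case True
        thus ?thesis using lower'[OF y(2)] lower'[OF y(3)] y(1,4) by (auto simp: chain_at_def inner_add_left)
      next
        case False
        hence "m \<le> min i m + min j m" by auto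
        hence "real m \<le> real (min i m) + real (min j m)" by (metis of_nat_add of_nat_mono)
        thus ?thesis using lower[OF y(2)] lower[OF y(3)] y(1,4) False by (auto simp: chain_at_def inner_add_left)
      qed
    qed
  qed
  show "tight_at P m x \<subseteq> {\<alpha>. indecomposable P m ?I \<alpha>}"
  proof
    fix \<alpha> assume a: "\<alpha> \<in> tight_at P m x"
    have False if "i + j = m" "\<beta> \<in> ?I i" "\<gamma> \<in> ?I j" "\<alpha> = \<beta> + \<gamma>" for i j \<beta> \<gamma>
    proof -
      have eq: "\<beta> \<bullet> x + \<gamma> \<bullet> x = real i + real j" using a that by (auto simp: tight_at_def inner_add_left)
      \<comment> \<open>A summand of level below \<open>m\<close> satisfies a strict bound, so the
        value of the sum would exceed \<open>m\<close>.\<close>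
      have "i < m \<or> j < m" using that m by auto
      thus False using eq lower[OF that(2)] lower[OF that(3)] lower'[OF that(2)] lower'[OF that(3)] that(1) by fastforce
    qed
    moreover have "\<alpha> \<in> ?I m" using a by (auto simp: tight_at_def chain_at_def)
    ultimately show "\<alpha> \<in> {\<alpha>. indecomposable P m ?I \<alpha>}" unfolding indecomposable_def by blast
  qed
  show "x \<in> chain_face P m ?I (tight_at P m x)"
    unfolding chain_face_def
  proof (intro CollectI conjI ballI allI impI)
    fix \<alpha> r assume *: "\<alpha> \<in> P" "r \<le> m"
    show "\<alpha> \<bullet> x > real r" if "\<alpha> \<in> ?I r \<and> \<not> (\<alpha> \<in> tight_at P m x \<and> r = m)"
      using that * by (cases "r = m") (auto simp: chain_at_def tight_at_def)
    show "\<alpha> \<bullet> x < real r" if "\<alpha> \<notin> ?I r" using upper[of \<alpha> r] that * by auto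
  qed (auto simp: tight_at_def)
qed

end

section \<open>Faces, the region and the walls of a fixed chain\<close>

context filter_chain
begin

lemma chain_face_sub_dominant: "chain_face P m I T \<subseteq> dominant_cone P"
proof
  fix x assume x: "x \<in> chain_face P m I T"
  show "x \<in> dominant_cone P" unfolding dominant_cone_def
  proof safe
    fix \<alpha> assume "\<alpha> \<in> P"
    thus "\<alpha> \<bullet> x > 0" using x m1 chain_0 unfolding chain_face_def by (force dest: spec[of _ "0::nat"])
  qed
qed

lemma chain_faceD:
  assumes "x \<in> chain_face P m I T" "\<alpha> \<in> P" "r \<le> m"
  shows "\<alpha> \<in> I r \<Longrightarrow> \<not> (\<alpha> \<in> T \<and> r = m) \<Longrightarrow> \<alpha> \<bullet> x > real r"
    and "\<alpha> \<notin> I r \<Longrightarrow> \<alpha> \<bullet> x < real r"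
    and "\<alpha> \<in> T \<Longrightarrow> \<alpha> \<bullet> x = real m"
  using assms unfolding chain_face_def by blast+

text \<open>Any single point of a face recovers its pair, so different pairs have disjoint
  faces.\<close>

lemma chain_at_face:
  assumes x: "x \<in> chain_face P m I T" and T: "T \<subseteq> indec"
  shows "chain_at P m x = I" and "tight_at P m x = T"
proof -
  have TI: "T \<subseteq> I m" and TP: "T \<subseteq> P" using T indec_sub chain_sub by blast+
  have lo: "\<alpha> \<bullet> x \<ge> real r" if "\<alpha> \<in> I r" "r \<le> m" for \<alpha> r
  proof -
    have "\<alpha> \<in> P" using that chain_sub by blast
    from chain_faceD(1,3)[OF x this that(2)] that show ?thesis
      by (cases "\<alpha> \<in> T \<and> r = m") auto
  qed
  show "chain_at P m x = I"
  proof
    fix r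
    show "chain_at P m x r = I r"
    proof (intro set_eqI)
      fix \<alpha>
      show "\<alpha> \<in> chain_at P m x r \<longleftrightarrow> \<alpha> \<in> I r"
      proof (cases "\<alpha> \<in> P")
        case True
        have "I r = I (min r m)" using chain_beyond[of r] by (cases "r \<le> m") (auto simp: min_def)
        moreover have "\<alpha> \<bullet> x > real r \<longleftrightarrow> \<alpha> \<in> I r" if "r < m"
          using chain_faceD(1,2)[OF x True, of r] that by force
        moreover have "\<alpha> \<bullet> x \<ge> real m \<longleftrightarrow> \<alpha> \<in> I m"
          using chain_faceD(2)[OF x True, of m] lo[of \<alpha> m] by force
        ultimately show ?thesis using True by (cases "r < m") (simp_all add: chain_at_def)
      next
        case False
        thus ?thesis using chain_sub[of r] by (auto simp: chain_at_def)
      qed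
    qed
  qed
  have "\<alpha> \<in> T" if a: "\<alpha> \<in> P" "\<alpha> \<bullet> x = real m" for \<alpha>
    using chain_faceD(1,2)[OF x a(1), of m] a by force
  thus "tight_at P m x = T" using TP x unfolding tight_at_def chain_face_def by auto
qed

text \<open>A nonempty relatively open subset of an affine set spans it; nonemptiness is the
  substantial input.\<close>

lemma affine_hull_chain_face:
  assumes T: "T \<subseteq> indec"
  shows "affine hull (chain_face P m I T) = {x. \<forall>\<alpha>\<in>T. \<alpha> \<bullet> x = real m}"
proof -
  obtain U where U: "open U" "convex U" "chain_face P m I T = {x. \<forall>\<alpha>\<in>T. \<alpha> \<bullet> x = real m} \<inter> U"
    by (rule chain_face_decomp[OF finite_pos])
  have "affine hull ({x. \<forall>\<alpha>\<in>T. \<alpha> \<bullet> x = real m} \<inter> U) = affine hull {x. \<forall>\<alpha>\<in>T. \<alpha> \<bullet> x = real m}"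
    using chain_face_nonempty[OF T] U(3)
    by (intro affine_hull_affine_Int_open affine_intersection_hyp U(1)) simp
  thus ?thesis unfolding U(3) using affine_intersection_hyp by simp
qed

lemma aff_dim_chain_face:
  assumes T: "T \<subseteq> indec"
  shows "aff_dim (chain_face P m I T) = int (DIM('a)) - int (card T)"
proof -
  obtain x where "x \<in> chain_face P m I T" using chain_face_nonempty[OF T] by blast
  hence "\<forall>\<alpha>\<in>T. \<alpha> \<bullet> x = real m" by (simp add: chain_face_def)
  from aff_dim_intersection_hyp[OF independent_indec[OF T] this] show ?thesis
    unfolding affine_hull_chain_face[OF T, symmetric] by simp
qed

abbreviation "region \<equiv> chain_face P m I {}"

lemma open_region: "open region" and convex_region: "convex region" and region_nonempty: "region \<noteq> {}"
proof -
  obtain U where U: "open U" "convex U" "region = {x. \<forall>\<alpha>\<in>{}. \<alpha> \<bullet> x = real m} \<inter> U"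
    by (rule chain_face_decomp[OF finite_pos])
  thus "open region" "convex region" by simp_all
qed (rule chain_face_nonempty, simp)

text \<open>Convexity keeps the region within one component. Conversely, by the intermediate value
  theorem, a connected set that avoids the hyperplanes cannot change sides.\<close>

lemma region_component:
  assumes x: "x \<in> region"
  shows "x \<in> arr_compl \<Phi> m" "connected_component_set (arr_compl \<Phi> m) x = region"
proof -
  have sub: "region \<subseteq> arr_compl \<Phi> m"
  proof
    fix y assume y: "y \<in> region"
    have "\<alpha> \<bullet> y \<noteq> real k" if a: "\<alpha> \<in> \<Phi>" and k: "k \<le> m" for \<alpha> k
    proof (cases "\<alpha> \<in> P")
      case True
      thus ?thesis using chain_faceD(1,2)[OF y True k] by force
    next
      case False
      hence "- \<alpha> \<in> P" using pos_or_neg a by blast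
      hence "\<alpha> \<bullet> y < 0" using chain_face_sub_dominant y by (force simp: dominant_cone_def)
      thus ?thesis by simp
    qed
    thus "y \<in> arr_compl \<Phi> m" unfolding arr_compl_def hyp_def by auto
  qed
  show xc: "x \<in> arr_compl \<Phi> m" using sub x by blast
  let ?K = "connected_component_set (arr_compl \<Phi> m) x"
  have "region \<subseteq> ?K"
    using convex_connected[OF convex_region] by (intro connected_component_maximal x sub)
  moreover have "y \<in> region" if y: "y \<in> ?K" for y
  proof -
    have K: "connected ?K" "x \<in> ?K" "?K \<subseteq> arr_compl \<Phi> m"
      using xc connected_component_subset by (auto simp: connected_component_refl)
    have avoid: "\<alpha> \<bullet> z \<noteq> real r" if "z \<in> ?K" "\<alpha> \<in> P" "r \<le> m" for z \<alpha> r
      using K(3) that pos_root_root unfolding arr_compl_def hyp_def by fastforce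
    show ?thesis unfolding chain_face_def
    proof (intro CollectI conjI ballI allI impI)
      fix \<alpha> r assume *: "\<alpha> \<in> P" "r \<le> m"
      show "\<alpha> \<bullet> y > real r" if "\<alpha> \<in> I r \<and> \<not> (\<alpha> \<in> {} \<and> r = m)"
        using chain_faceD(1)[OF x *] that connected_ivt_hyperplane[OF K(1) y K(2), of \<alpha> "real r"] avoid[OF _ *]
        by force
      show "\<alpha> \<bullet> y < real r" if "\<alpha> \<notin> I r"
        using chain_faceD(2)[OF x *] that connected_ivt_hyperplane[OF K(1) K(2) y, of \<alpha> "real r"] avoid[OF _ *]
        by force
    qed auto
  qed
  ultimately show "?K = region" by blast
qed

text \<open>If \<open>\<alpha>\<close> decomposes, both summands attain their lower bounds on the
  facet, so the wall would also be a hyperplane of a summand. If it does not, the nonempty face of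
  \<open>{\<alpha>}\<close> lies in the closure and spans the hyperplane, which yields a
  facet.\<close>

lemma sep_walls_region:
  assumes irr: "irreducible_root_system \<Phi>"
  shows "sep_walls \<Phi> \<Delta> m region = (\<lambda>\<alpha>. hyp \<alpha> (real m)) ` indec"
proof (intro equalityI subsetI)
  obtain x where x: "x \<in> region" using region_nonempty by blast
  obtain y where y: "y \<in> fund_alcove \<Phi> \<Delta>" using fund_alcove_nonempty[OF irr] by blast
  have ypos: "\<alpha> \<bullet> y \<ge> 0" if "\<alpha> \<in> P" for \<alpha>
    using y pos_coord_nonneg[OF that] by (subst inner_pos_root[OF that])
      (auto simp: fund_alcove_def less_imp_le intro!: sum_nonneg mult_nonneg_nonneg)
  have alcove: "z \<in> hlt \<alpha> (real m)" if "z \<in> fund_alcove \<Phi> \<Delta>" "\<alpha> \<in> P" for z \<alpha>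
    using fund_alcove_less_1[OF irr that] m1 by (simp add: hlt_def)
  fix H
  {
    assume "H \<in> sep_walls \<Phi> \<Delta> m region"
    then obtain \<alpha> where a: "\<alpha> \<in> \<Phi>" "H = hyp \<alpha> (real m)" "is_wall region H"
        "separates \<alpha> (real m) region (fund_alcove \<Phi> \<Delta>)" unfolding sep_walls_def by blast
    \<comment> \<open>A negative root takes nonpositive values at both \<open>x\<close> and
      \<open>y\<close>, so a hyperplane of level \<open>m \<ge> 1\<close> cannot separate
      them.\<close>
    have aP: "\<alpha> \<in> P"
    proof (rule ccontr)
      assume "\<alpha> \<notin> P"
      hence neg: "- \<alpha> \<in> P" using pos_or_neg a(1) by blast
      have "\<alpha> \<bullet> x \<le> 0" using chain_face_sub_dominant x neg by (force simp: dominant_cone_def)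
      moreover have "\<alpha> \<bullet> y \<le> 0" using ypos[OF neg] by simp
      ultimately show False using a(4) x y m1 by (force simp: separates_def hgt_def)
    qed
    have gt: "region \<subseteq> hgt \<alpha> (real m)" using a(4) alcove[OF y aP] y by (force simp: separates_def hgt_def hlt_def)
    hence aI: "\<alpha> \<in> I m" using chain_faceD(2)[OF x aP, of m] x by (force simp: hgt_def)
    have "False" if ij: "i + j = m" and b: "\<beta> \<in> I i" and g: "\<gamma> \<in> I j" and bg: "\<alpha> = \<beta> + \<gamma>" for i j \<beta> \<gamma>
    proof -
      obtain F where F: "F facet_of closure region" "affine hull F = hyp \<alpha> (real m)"
        using a(2,3) unfolding is_wall_def by blast
      have cl: "closure region \<subseteq> {z. \<delta> \<bullet> z \<ge> real r}" if "\<delta> \<in> I r" "r \<le> m" for \<delta> r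
      proof (intro closure_minimal closed_halfspace_ge subsetI CollectI)
        fix z assume "z \<in> region"
        moreover have "\<delta> \<in> P" using that chain_sub by blast
        ultimately show "\<delta> \<bullet> z \<ge> real r" using chain_faceD(1)[of z "{}" \<delta> r] that by simp
      qed
      have "F \<subseteq> hyp \<beta> (real i)"
      proof
        fix z assume z: "z \<in> F"
        hence "z \<in> closure region" using facet_of_imp_subset[OF F(1)] by blast
        hence "\<beta> \<bullet> z \<ge> real i" "\<gamma> \<bullet> z \<ge> real j" using cl[OF b] cl[OF g] ij by auto
        moreover have "\<alpha> \<bullet> z = real m" using F(2) z hull_inc[of z F affine] by (auto simp: hyp_def)
        ultimately show "z \<in> hyp \<beta> (real i)" using ij bg by (auto simp: hyp_def inner_add_left)
      qed
      hence "affine hull F \<subseteq> hyp \<beta> (real i)"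
        by (intro hull_minimal) (auto simp: hyp_def intro: affine_hyperplane)
      then obtain t where t: "\<beta> = t *\<^sub>R \<alpha>" using F(2) hyp_subset_parallel a(1) zero_not_root by metis
      hence "t = 1" using pos_root_scaleR[OF aP] b chain_sub by blast
      hence "\<gamma> = 0" using t bg by simp
      thus False using g chain_sub pos_root_root zero_not_root by blast
    qed
    hence "\<alpha> \<in> indec" using aI unfolding indecomposable_def by blast
    thus "H \<in> (\<lambda>\<alpha>. hyp \<alpha> (real m)) ` indec" using a(2) by blast
  next
    assume "H \<in> (\<lambda>\<alpha>. hyp \<alpha> (real m)) ` indec"
    then obtain \<alpha> where a: "\<alpha> \<in> indec" "H = hyp \<alpha> (real m)" by blast
    have aI: "\<alpha> \<in> I m" using a(1) indec_sub by blast
    hence aP: "\<alpha> \<in> P" using chain_sub by blast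
    have "region \<subseteq> hgt \<alpha> (real m)" using chain_faceD(1)[OF _ aP order_refl aI, of _ "{}"] by (auto simp: hgt_def)
    moreover have "fund_alcove \<Phi> \<Delta> \<subseteq> hlt \<alpha> (real m)" using alcove aP by blast
    ultimately have sep: "separates \<alpha> (real m) region (fund_alcove \<Phi> \<Delta>)" by (simp add: separates_def)
    have T: "{\<alpha>} \<subseteq> indec" using a by blast
    let ?G = "chain_face P m I {\<alpha>}"
    have hG: "affine hull ?G = hyp \<alpha> (real m)" using affine_hull_chain_face[OF T] by (simp add: hyp_def)
    have "?G \<subseteq> closure region"
    proof
      fix z assume z: "z \<in> ?G"
      \<comment> \<open>The open segment from \<open>z\<close> to the point \<open>x\<close> of the
        region lies in the region, so its endpoint \<open>z\<close> lies in the closure.\<close>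
      let ?h = "\<lambda>t. (1 - t) *\<^sub>R z + t *\<^sub>R x"
      have "?h t \<in> region" if t: "t \<in> {0<..<1}" for t :: real
        unfolding chain_face_def
      proof (intro CollectI conjI ballI allI impI)
        fix \<beta> r assume *: "\<beta> \<in> P" "r \<le> m"
        have *: "\<beta> \<bullet> ?h t - real r = (1 - t) * (\<beta> \<bullet> z - real r) + t * (\<beta> \<bullet> x - real r)"
          and t: "0 < t" "t < 1" using t by (auto simp: inner_add_right algebra_simps)
        show "\<beta> \<bullet> ?h t > real r" if "\<beta> \<in> I r \<and> \<not> (\<beta> \<in> {} \<and> r = m)"
        proof -
          have "\<beta> \<bullet> x > real r" using chain_faceD(1)[OF x \<open>\<beta> \<in> P\<close> \<open>r \<le> m\<close>] that by blast
          moreover have "\<beta> \<bullet> z \<ge> real r"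
            using chain_faceD(1,3)[OF z \<open>\<beta> \<in> P\<close> \<open>r \<le> m\<close>] that by (cases "\<beta> \<in> {\<alpha>} \<and> r = m") (auto simp: less_imp_le)
          ultimately have "(1 - t) * (\<beta> \<bullet> z - real r) + t * (\<beta> \<bullet> x - real r) > 0"
            using t by (intro add_nonneg_pos mult_nonneg_nonneg mult_pos_pos) auto
          thus ?thesis using * by linarith
        qed
        show "\<beta> \<bullet> ?h t < real r" if "\<beta> \<notin> I r"
        proof -
          have "\<beta> \<bullet> x < real r" "\<beta> \<bullet> z < real r"
            using chain_faceD(2)[OF x \<open>\<beta> \<in> P\<close> \<open>r \<le> m\<close>] chain_faceD(2)[OF z \<open>\<beta> \<in> P\<close> \<open>r \<le> m\<close>] that by auto
          hence "(1 - t) * (\<beta> \<bullet> z - real r) + t * (\<beta> \<bullet> x - real r) < 0"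
            using t by (intro add_neg_neg mult_pos_neg) auto
          thus ?thesis using * by linarith
        qed
      qed auto
      hence "?h ` closure {0<..<1} \<subseteq> closure region"
        by (intro image_closure_subset) (auto intro!: continuous_intros subsetD[OF closure_subset])
      moreover have "?h 0 \<in> ?h ` closure {0<..<1}" by (intro imageI) simp
      ultimately show "z \<in> closure region" by auto
    qed
    hence GF: "?G \<subseteq> closure region \<inter> hyp \<alpha> (real m)"
      using hull_subset[of ?G affine] hG by auto
    let ?F = "closure region \<inter> hyp \<alpha> (real m)"
    have "affine hull ?F \<subseteq> hyp \<alpha> (real m)"
      by (intro hull_minimal) (auto simp: hyp_def intro: affine_hyperplane)
    moreover have "affine hull ?G \<subseteq> affine hull ?F" by (rule hull_mono[OF GF])
    ultimately have hF: "affine hull ?F = hyp \<alpha> (real m)" using hG by blast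
    have "closure region \<subseteq> {z. \<alpha> \<bullet> z \<ge> real m}"
      using \<open>region \<subseteq> hgt \<alpha> (real m)\<close>
      by (intro closure_minimal closed_halfspace_ge) (auto simp: hgt_def)
    hence "?F face_of closure region" unfolding hyp_def
      by (intro face_of_Int_supporting_hyperplane_ge convex_closure convex_region) auto
    moreover have "?F \<noteq> {}" using GF chain_face_nonempty[OF T] by blast
    moreover have "aff_dim ?F = int (DIM('a)) - 1"
    proof -
      have "\<alpha> \<noteq> 0" using aP pos_root_root zero_not_root by blast
      hence "aff_dim (hyp \<alpha> (real m)) = int (DIM('a)) - 1" by (simp add: hyp_def)
      thus ?thesis using hF by (metis aff_dim_affine_hull)
    qed
    moreover have "aff_dim (closure region) = int (DIM('a))"
      using aff_dim_open[OF open_region region_nonempty] by (simp add: closure_aff_dim)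
    ultimately have "is_wall region H" unfolding is_wall_def facet_of_def using hF a(2) by force
    thus "H \<in> sep_walls \<Phi> \<Delta> m region" using sep a aP pos_root_root unfolding sep_walls_def by blast
  }
qed

lemma inj_on_hyp: "inj_on (\<lambda>\<alpha>. hyp \<alpha> (real m)) indec"
proof (rule inj_onI)
  fix \<alpha> \<beta> assume ab: "\<alpha> \<in> indec" "\<beta> \<in> indec" "hyp \<alpha> (real m) = hyp \<beta> (real m)"
  have P: "\<alpha> \<in> P" "\<beta> \<in> P" using ab indec_sub chain_sub by blast+
  hence "\<alpha> \<noteq> 0" using pos_root_root zero_not_root by blast
  then obtain t where t: "\<beta> = t *\<^sub>R \<alpha>" using hyp_subset_parallel ab(3) by blast
  hence "t = 1" using pos_root_scaleR P by blast
  thus "\<alpha> = \<beta>" using t by simp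
qed

end

section \<open>Counting\<close>

text \<open>With \<open>x = y + 1\<close> the right-hand side is the sum of
  \<open>(y + 1) ^ N c\<close> over \<open>C\<close>, and \<open>f k\<close> is the coefficient of
  \<open>y ^ (D - k)\<close>. The bound on \<open>N\<close> ensures that every \<open>c\<close> is
  counted.\<close>

lemma binomial_transform_coeff:
  fixes f :: "nat \<Rightarrow> real" and N :: "'i \<Rightarrow> nat"
  assumes fin: "finite C" and N: "\<And>c. c \<in> C \<Longrightarrow> N c \<le> D" and k: "k \<le> D"
    and eq: "\<And>x. (\<Sum>i\<le>D. f i * (x - 1) ^ (D - i))
      = (\<Sum>i\<le>D. real (card {c \<in> C. N c = D - i}) * x ^ (D - i))"
  shows "f k = (\<Sum>c\<in>C. real (N c choose (D - k)))"
proof -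
  have rev: "(\<Sum>i\<le>D. g (D - i) i) = (\<Sum>j\<le>D. g j (D - j))" for g :: "nat \<Rightarrow> nat \<Rightarrow> real"
    by (rule sum.reindex_bij_witness[of _ "\<lambda>j. D - j" "\<lambda>j. D - j"]) auto
  have "(\<Sum>j\<le>D. f (D - j) * y ^ j) = (\<Sum>j\<le>D. (\<Sum>c\<in>C. real (N c choose j)) * y ^ j)" for y
  proof -
    have "(\<Sum>j\<le>D. f (D - j) * y ^ j) = (\<Sum>i\<le>D. f i * ((y + 1) - 1) ^ (D - i))"
      using rev[of "\<lambda>j i. f i * y ^ j"] by simp
    also have "\<dots> = (\<Sum>i\<le>D. real (card {c \<in> C. N c = D - i}) * (y + 1) ^ (D - i))" by (rule eq)
    also have "\<dots> = (\<Sum>j\<le>D. real (card {c \<in> C. N c = j}) * (y + 1) ^ j)"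
      using rev[of "\<lambda>j i. real (card {c \<in> C. N c = j}) * (y + 1) ^ j"] by simp
    also have "\<dots> = (\<Sum>j\<le>D. \<Sum>c | c \<in> C \<and> N c = j. (y + 1) ^ N c)"
      by (intro sum.cong) auto
    also have "\<dots> = (\<Sum>c\<in>C. (y + 1) ^ N c)"
      using N by (intro sum.group fin) auto
    also have "\<dots> = (\<Sum>c\<in>C. \<Sum>j\<le>D. real (N c choose j) * y ^ j)"
    proof (rule sum.cong)
      fix c assume "c \<in> C"
      have "(y + 1) ^ N c = (\<Sum>j\<le>N c. real (N c choose j) * y ^ j)" by (simp add: binomial_ring)
      also have "\<dots> = (\<Sum>j\<le>D. real (N c choose j) * y ^ j)"
        using N[OF \<open>c \<in> C\<close>] by (intro sum.mono_neutral_left) auto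
      finally show "(y + 1) ^ N c = (\<Sum>j\<le>D. real (N c choose j) * y ^ j)" .
    qed simp
    also have "\<dots> = (\<Sum>j\<le>D. (\<Sum>c\<in>C. real (N c choose j)) * y ^ j)"
      by (subst sum.swap) (simp add: sum_distrib_right)
    finally show ?thesis .
  qed
  hence "\<forall>j\<le>D. f (D - j) = (\<Sum>c\<in>C. real (N c choose j))"
    by (subst polyfun_eq_coeffs[symmetric]) blast
  from this[rule_format, of "D - k"] show ?thesis using k by simp
qed

context filter_chain
begin

text \<open>Translates the bounds given by a chain into the sign vectors behind
  \<open>F_faces\<close>; any point of the face supplies the signs.\<close>

lemma chain_face_sgn:
  assumes T: "T \<subseteq> indec" and x: "x \<in> chain_face P m I T"
  shows "chain_face P m I T = {y. \<forall>\<alpha>\<in>P. \<forall>r\<le>m. sgn (\<alpha> \<bullet> y - real r) = sgn (\<alpha> \<bullet> x - real r)}"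
proof (intro equalityI subsetI)
  have TI: "T \<subseteq> I m" and TP: "T \<subseteq> P" using T indec_sub chain_sub by blast+
  {
    fix y assume y: "y \<in> chain_face P m I T"
    have "sgn (\<alpha> \<bullet> y - real r) = sgn (\<alpha> \<bullet> x - real r)" if "\<alpha> \<in> P" "r \<le> m" for \<alpha> r
    proof -
      consider "\<alpha> \<in> T \<and> r = m" | "\<alpha> \<in> I r" "\<not> (\<alpha> \<in> T \<and> r = m)" | "\<alpha> \<notin> I r" using TI by blast
      thus ?thesis
        using chain_faceD[OF x that] chain_faceD[OF y that] by cases auto
    qed
    thus "y \<in> {y. \<forall>\<alpha>\<in>P. \<forall>r\<le>m. sgn (\<alpha> \<bullet> y - real r) = sgn (\<alpha> \<bullet> x - real r)}" by blast
  }
  fix y assume "y \<in> {y. \<forall>\<alpha>\<in>P. \<forall>r\<le>m. sgn (\<alpha> \<bullet> y - real r) = sgn (\<alpha> \<bullet> x - real r)}"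
  hence y: "sgn (\<alpha> \<bullet> y - real r) = sgn (\<alpha> \<bullet> x - real r)" if "\<alpha> \<in> P" "r \<le> m" for \<alpha> r using that by blast
  show "y \<in> chain_face P m I T" unfolding chain_face_def
  proof (intro CollectI conjI ballI allI impI)
    fix \<alpha> r assume *: "\<alpha> \<in> P" "r \<le> m"
    show "\<alpha> \<bullet> y > real r" if "\<alpha> \<in> I r \<and> \<not> (\<alpha> \<in> T \<and> r = m)"
      using chain_faceD(1)[OF x *] y[OF *] that by (auto simp: sgn_if split: if_splits)
    show "\<alpha> \<bullet> y < real r" if "\<alpha> \<notin> I r"
      using chain_faceD(2)[OF x *] y[OF *] that by (auto simp: sgn_if split: if_splits)
  next
    fix \<alpha> assume "\<alpha> \<in> T"
    thus "\<alpha> \<bullet> y = real m" using chain_faceD(3)[OF x _ order_refl] y[OF _ order_refl, of \<alpha>] TP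
      by (auto simp: sgn_if split: if_splits)
  qed
qed

end

section \<open>Chains against regions and faces\<close>

context based_root_system
begin

abbreviation "indec_of m I \<equiv> {\<alpha>. indecomposable P m I \<alpha>}"

lemma filter_chainI: "m \<ge> 1 \<Longrightarrow> geometric_chain P m I \<Longrightarrow> filter_chain \<Phi> \<Delta> m I"
  by (simp add: filter_chain_def filter_chain_axioms_def based_root_system_axioms)

lemma dominant_regions_eq:
  assumes m: "m \<ge> 1"
  shows "dominant_regions \<Phi> \<Delta> m = (\<lambda>I. chain_face P m I {}) ` {I. geometric_chain P m I}"
proof (intro equalityI subsetI)
  fix R assume "R \<in> dominant_regions \<Phi> \<Delta> m"
  then obtain x where x: "x \<in> arr_compl \<Phi> m" "R = connected_component_set (arr_compl \<Phi> m) x"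
      "R \<subseteq> dominant_cone P" unfolding dominant_regions_def regions_def by blast
  have xd: "x \<in> dominant_cone P" using x by (auto simp: connected_component_refl)
  have off: "\<alpha> \<bullet> x \<noteq> real r" if "\<alpha> \<in> P" "r \<le> m" for \<alpha> r
    using x(1) that pos_root_root unfolding arr_compl_def hyp_def by fastforce
  let ?I = "chain_at P m x"
  have geo: "geometric_chain P m ?I" and "x \<in> chain_face P m ?I (tight_at P m x)"
    using chain_at_geometric[OF m xd] off by auto
  moreover have "tight_at P m x = {}" using off by (auto simp: tight_at_def)
  ultimately have "x \<in> chain_face P m ?I {}" by simp
  hence "R = chain_face P m ?I {}"
    unfolding x(2) using filter_chain.region_component(2)[OF filter_chainI[OF m geo]] by blast
  thus "R \<in> (\<lambda>I. chain_face P m I {}) ` {I. geometric_chain P m I}" using geo by blast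
next
  fix R assume "R \<in> (\<lambda>I. chain_face P m I {}) ` {I. geometric_chain P m I}"
  then obtain I where I: "geometric_chain P m I" "R = chain_face P m I {}" by blast
  interpret filter_chain \<Phi> \<Delta> m I by (rule filter_chainI[OF m I(1)])
  obtain x where x: "x \<in> region" using region_nonempty by blast
  show "R \<in> dominant_regions \<Phi> \<Delta> m"
    unfolding dominant_regions_def regions_def I(2)
    using region_component[OF x] chain_face_sub_dominant by blast
qed

lemma chain_face_inject:
  assumes m: "m \<ge> 1" and I: "geometric_chain P m I" "T \<subseteq> indec_of m I"
    and I': "geometric_chain P m I'" "T' \<subseteq> indec_of m I'"
    and eq: "chain_face P m I T = chain_face P m I' T'"
  shows "I = I'" "T = T'"
proof -
  interpret A: filter_chain \<Phi> \<Delta> m I by (rule filter_chainI[OF m I(1)])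
  interpret B: filter_chain \<Phi> \<Delta> m I' by (rule filter_chainI[OF m I'(1)])
  obtain x where x: "x \<in> chain_face P m I T" using A.chain_face_nonempty[OF I(2)] by blast
  hence x': "x \<in> chain_face P m I' T'" using eq by simp
  show "I = I'" "T = T'"
    using A.chain_at_face[OF x I(2)] B.chain_at_face[OF x' I'(2)] by simp_all
qed

text \<open>Sign 0 can occur only at level \<open>m\<close>, so every point of a cell yields a chain
  with its tight roots, and the codimension formula turns dimension \<open>k\<close> into the size
  of \<open>T\<close>.\<close>

lemma F_faces_eq:
  assumes m: "m \<ge> 1" and k: "k \<le> DIM('a)"
  shows "F_faces \<Phi> \<Delta> m k = (\<lambda>(I, T). chain_face P m I T) `
    {(I, T). geometric_chain P m I \<and> T \<subseteq> indec_of m I \<and> card T = DIM('a) - k}" (is "_ = _ ` ?G")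
proof (intro equalityI subsetI)
  have cell: "\<Inter>{signed_half \<alpha> (real r) (s \<alpha> r) | \<alpha> r. \<alpha> \<in> P \<and> r \<le> m}
      = {y. \<forall>\<alpha>\<in>P. \<forall>r\<le>m. sgn (\<alpha> \<bullet> y - real r) = s \<alpha> r}" for s
    unfolding signed_half_def by blast
  fix X
  {
    assume "X \<in> F_faces \<Phi> \<Delta> m k"
    then obtain s where s: "valid_signs P m s" "X = {y. \<forall>\<alpha>\<in>P. \<forall>r\<le>m. sgn (\<alpha> \<bullet> y - real r) = s \<alpha> r}"
      "X \<noteq> {}" "aff_dim X = int k" unfolding F_faces_def cell by blast
    obtain x where x: "x \<in> X" using s(3) by blast
    have sx: "s \<alpha> r = sgn (\<alpha> \<bullet> x - real r)" if "\<alpha> \<in> P" "r \<le> m" for \<alpha> r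
      using x s(2) that by simp
    have pos: "\<alpha> \<bullet> x > 0" if "\<alpha> \<in> P" for \<alpha>
    proof -
      have "sgn (\<alpha> \<bullet> x) = 1" using sx[OF that, of 0] s(1) that by (simp add: valid_signs_def)
      thus ?thesis by (simp add: sgn_1_pos)
    qed
    have off: "\<alpha> \<bullet> x \<noteq> real r" if "\<alpha> \<in> P" "r < m" for \<alpha> r
    proof (cases "r = 0")
      case False
      hence "s \<alpha> r \<in> {-1, 1}" using s(1) that by (simp add: valid_signs_def)
      thus ?thesis using sx[OF that(1), of r] that by auto
    qed (use pos that in force)
    let ?I = "chain_at P m x" and ?T = "tight_at P m x"
    have xd: "x \<in> dominant_cone P" using pos by (simp add: dominant_cone_def)
    note c = chain_at_geometric[OF m xd off]
    interpret filter_chain \<Phi> \<Delta> m ?I by (rule filter_chainI[OF m c(1)])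
    have "chain_face P m ?I ?T = {y. \<forall>\<alpha>\<in>P. \<forall>r\<le>m. sgn (\<alpha> \<bullet> y - real r) = sgn (\<alpha> \<bullet> x - real r)}"
      by (rule chain_face_sgn[OF c(2,3)])
    also have "\<dots> = X" unfolding s(2) using sx by simp
    finally have X: "X = chain_face P m ?I ?T" ..
    have "int k = int (DIM('a)) - int (card ?T)" using s(4) aff_dim_chain_face[OF c(2)] X by simp
    hence "card ?T = DIM('a) - k" by linarith
    thus "X \<in> (\<lambda>(I, T). chain_face P m I T) ` ?G" using X c(1,2) by blast
  next
    assume "X \<in> (\<lambda>(I, T). chain_face P m I T) ` ?G"
    then obtain I T where I: "geometric_chain P m I" "T \<subseteq> indec_of m I" "card T = DIM('a) - k"
      "X = chain_face P m I T" by blast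
    interpret filter_chain \<Phi> \<Delta> m I by (rule filter_chainI[OF m I(1)])
    obtain x where x: "x \<in> chain_face P m I T" using chain_face_nonempty[OF I(2)] by blast
    define s where "s \<alpha> r = sgn (\<alpha> \<bullet> x - real r)" for \<alpha> and r :: nat
    have "s \<alpha> 0 = 1" if "\<alpha> \<in> P" for \<alpha>
      using subsetD[OF chain_face_sub_dominant x] that by (simp add: s_def dominant_cone_def)
    moreover have "s \<alpha> r \<in> {-1, 1}" if "\<alpha> \<in> P" "r < m" for \<alpha> r
      using chain_faceD(1,2)[OF x that(1), of r] that(2) by (cases "\<alpha> \<in> I r") (auto simp: s_def)
    moreover have "s \<alpha> r \<in> {-1, 0, 1}" for \<alpha> r by (auto simp: s_def sgn_if)
    ultimately have "valid_signs P m s" unfolding valid_signs_def by blast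
    moreover have "X = {y. \<forall>\<alpha>\<in>P. \<forall>r\<le>m. sgn (\<alpha> \<bullet> y - real r) = s \<alpha> r}"
      unfolding I(4) chain_face_sgn[OF I(2) x] s_def ..
    moreover have "aff_dim X = int k" using aff_dim_chain_face[OF I(2)] I(3,4) k by simp
    moreover have "X \<noteq> {}" using x I(4) by blast
    ultimately show "X \<in> F_faces \<Phi> \<Delta> m k" unfolding F_faces_def cell by blast
  }
qed

text \<open>Chains are functions on all naturals, but they are constant beyond \<open>m\<close>, so
  their finite graph up to \<open>m\<close> determines them.\<close>

lemma finite_chains: "finite {I. geometric_chain P m I}"
proof (rule finite_imageD)
  let ?g = "\<lambda>I :: nat \<Rightarrow> 'a set. {(\<alpha>, r). r \<le> m \<and> \<alpha> \<in> I r}"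
  have sub: "I r \<subseteq> P" if "geometric_chain P m I" "r \<le> m" for I r
    using that by (auto simp: geometric_chain_def is_filter_def)
  have "?g ` {I. geometric_chain P m I} \<subseteq> Pow (P \<times> {..m})" using sub by blast
  thus "finite (?g ` {I. geometric_chain P m I})"
    using finite_pos by (meson finite_Pow_iff finite_SigmaI finite_atMost finite_subset)
  show "inj_on ?g {I. geometric_chain P m I}"
  proof (rule inj_onI, rule ext)
    fix I I' :: "nat \<Rightarrow> 'a set" and r
    assume g: "I \<in> {I. geometric_chain P m I}" "I' \<in> {I. geometric_chain P m I}" and "?g I = ?g I'"
    hence le: "I r = I' r" if "r \<le> m" for r using that by blast
    show "I r = I' r"
    proof (cases "r \<le> m")
      case False
      hence "I r = I m" "I' r = I' m" using g by (auto simp: geometric_chain_def)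
      thus ?thesis using le[of m] by simp
    qed (rule le)
  qed
qed

end

theorem theorem5p1:
  fixes \<Phi> \<Delta> :: "'a::euclidean_space set" and m k :: nat and f :: "nat \<Rightarrow> real"
  assumes "crystallographic_root_system \<Phi>" and "irreducible_root_system \<Phi>"
    and "is_base \<Phi> \<Delta>" and "m \<ge> 1" and "k \<le> DIM('a)"
    and "\<forall>x::real. (\<Sum>i\<le>DIM('a). f i * (x - 1) ^ (DIM('a) - i))
                 = (\<Sum>i\<le>DIM('a). real (h_num \<Phi> \<Delta> m i) * x ^ (DIM('a) - i))"
  shows "f k = real (card {(R, S). R \<in> dominant_regions \<Phi> \<Delta> m \<and>
                   S \<subseteq> sep_walls \<Phi> \<Delta> m R \<and> card S = DIM('a) - k}) \<and>
         f k = real (card {(I, T). geometric_chain (pos_roots \<Phi> \<Delta>) m I \<and>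
                   T \<subseteq> {\<alpha>. indecomposable (pos_roots \<Phi> \<Delta>) m I \<alpha>} \<and> card T = DIM('a) - k}) \<and>
         f k = real (card (F_faces \<Phi> \<Delta> m k))"
proof -
  interpret based_root_system \<Phi> \<Delta> using assms(1,3) by unfold_locales
  note m = assms(4) and k = assms(5)
  define C where "C = {I. geometric_chain P m I}"
  let ?R = "\<lambda>I. chain_face P m I {}"
  let ?h = "\<lambda>\<alpha>. hyp \<alpha> (real m)"
  let ?G = "{(I, T). geometric_chain P m I \<and> T \<subseteq> indec_of m I \<and> card T = DIM('a) - k}"
  have fc: "filter_chain \<Phi> \<Delta> m I" if "I \<in> C" for I using that filter_chainI[OF m] by (simp add: C_def)
  have injR: "inj_on ?R C"
    by (intro inj_onI chain_face_inject(1)[OF m, of _ "{}" _ "{}"]) (simp_all add: C_def)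
  have walls: "sep_walls \<Phi> \<Delta> m (?R I) = ?h ` indec_of m I" and injh: "inj_on ?h (indec_of m I)"
    if "I \<in> C" for I
    using filter_chain.sep_walls_region[OF fc[OF that] assms(2)] filter_chain.inj_on_hyp[OF fc[OF that]] by auto
  \<comment> \<open>Linear independence bounds the number of indecomposables by the rank, so every
    chain is counted by some \<open>h_num\<close> with index at most \<open>DIM('a)\<close>.\<close>
  have fin_indec: "finite (indec_of m I)" and card_indec: "card (indec_of m I) \<le> DIM('a)" if "I \<in> C" for I
    using independent_bound[OF filter_chain.independent_indec[OF fc[OF that] order_refl]] by auto
  have DR: "dominant_regions \<Phi> \<Delta> m = ?R ` C" using dominant_regions_eq[OF m] by (simp add: C_def)
  have h: "h_num \<Phi> \<Delta> m i = card {I \<in> C. card (indec_of m I) = DIM('a) - i}" for i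
  proof -
    have "{R \<in> dominant_regions \<Phi> \<Delta> m. card (sep_walls \<Phi> \<Delta> m R) = DIM('a) - i}
        = ?R ` {I \<in> C. card (indec_of m I) = DIM('a) - i}"
      unfolding DR using walls card_image[OF injh] by auto
    moreover have "inj_on ?R {I \<in> C. card (indec_of m I) = DIM('a) - i}"
      using injR by (rule inj_on_subset) auto
    ultimately show ?thesis unfolding h_num_def by (simp add: card_image)
  qed
  have "f k = (\<Sum>I\<in>C. real (card (indec_of m I) choose (DIM('a) - k)))"
  proof (rule binomial_transform_coeff)
    show "finite C" unfolding C_def by (rule finite_chains)
  qed (use card_indec k assms(6) h in auto)
  also have "\<dots> = real (\<Sum>I\<in>C. card {T. T \<subseteq> indec_of m I \<and> card T = DIM('a) - k})"
    using n_subsets[OF fin_indec] by simp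
  also have "\<dots> = real (card (SIGMA I:C. {T. T \<subseteq> indec_of m I \<and> card T = DIM('a) - k}))"
    using finite_chains fin_indec by (subst card_SigmaI) (auto simp: C_def)
  also have "(SIGMA I:C. {T. T \<subseteq> indec_of m I \<and> card T = DIM('a) - k}) = ?G"
    by (auto simp: C_def)
  finally have ii: "f k = real (card ?G)" .
  have "inj_on (\<lambda>(I, T). chain_face P m I T) ?G"
    by (rule inj_onI, clarify) (meson chain_face_inject[OF m])
  hence iii: "card (F_faces \<Phi> \<Delta> m k) = card ?G" unfolding F_faces_eq[OF m k] by (rule card_image)
  \<comment> \<open>Since \<open>?h\<close> is injective on the indecomposables, sets of separating
    walls correspond to sets of indecomposables of the same size.\<close>
  have "{(R, S). R \<in> dominant_regions \<Phi> \<Delta> m \<and> S \<subseteq> sep_walls \<Phi> \<Delta> m R \<and> card S = DIM('a) - k}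
      = (\<lambda>(I, T). (?R I, ?h ` T)) ` ?G" (is "?L = _")
  proof (intro equalityI subsetI)
    fix p assume "p \<in> ?L"
    then obtain I S where p: "p = (?R I, S)" "I \<in> C" "S \<subseteq> ?h ` indec_of m I" "card S = DIM('a) - k"
      unfolding DR using walls by auto
    from p(3) obtain T where T: "T \<subseteq> indec_of m I" "S = ?h ` T" by (auto elim: subset_imageE)
    have "card T = DIM('a) - k" using card_image[OF inj_on_subset[OF injh[OF p(2)] T(1)]] p(4) T(2) by simp
    thus "p \<in> (\<lambda>(I, T). (?R I, ?h ` T)) ` ?G" using p T by (auto simp: C_def)
  next
    fix p assume "p \<in> (\<lambda>(I, T). (?R I, ?h ` T)) ` ?G"
    then obtain I T where p: "p = (?R I, ?h ` T)" "I \<in> C" "T \<subseteq> indec_of m I" "card T = DIM('a) - k"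
      by (auto simp: C_def)
    have "card (?h ` T) = DIM('a) - k" using card_image[OF inj_on_subset[OF injh[OF p(2)] p(3)]] p(4) by simp
    moreover have "?h ` T \<subseteq> ?h ` indec_of m I" using p(3) by (rule image_mono)
    ultimately show "p \<in> ?L" unfolding p(1) DR using walls[OF p(2)] p(2) by auto
  qed
  moreover have "inj_on (\<lambda>(I, T). (?R I, ?h ` T)) ?G"
  proof (rule inj_onI, clarify)
    fix I T I' T'
    assume a: "geometric_chain P m I" "T \<subseteq> indec_of m I" "geometric_chain P m I'" "T' \<subseteq> indec_of m I'"
      and eq: "?R I = ?R I'" "?h ` T = ?h ` T'"
    have "I = I'" using inj_onD[OF injR, of I I'] eq(1) a by (simp add: C_def)
    moreover from this have "T = T'"
      using inj_on_image_eq_iff[OF injh[of I]] a eq(2) by (simp add: C_def)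
    ultimately show "I = I' \<and> T = T'" by blast
  qed
  ultimately have i: "card ?L = card ?G" by (simp add: card_image)
  show ?thesis using i ii iii by simp
qed

end
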